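(* Let $\varphi:=\log\circ\lambda:\Omega^*([0,1])\to C^*_\infty([0,1])$ and $\varphi_s:=\varphi\circ\beta_s^*$, where $\beta_s(t)=s\cdot t$. The $n$-th Taylor coefficient $\varphi_{s,n}$ of the $C_\infty$ morphism $\varphi_s$ is given by $$\varphi_{s,n}(\mathbf{s}a_1(t)dt\otimes\cdots\otimes\mathbf{s}a_n(t)dt)=\mathcal{M}_n(a_1(t)\otimes\cdots\otimes a_n(t))(s)\,\mathbf{s}dt,$$ where the maps $\mathcal{M}_n:(\Omega^0([0,1]))^{\otimes n}\to\Omega^0([0,1])$, $n\ge1$, are defined recursively by $\mathcal{M}_1(a_1(t))(s)=\int_0^sa_1(t_1)dt_1$ and, for $n\ge2$, $$\mathcal{M}_n(a_1(t)\otimes\cdots\otimes a_n(t))(s)=\sum_{k=1}^{n-1}\frac{B_k}{k!}\sum_{j=0}^k(-1)^j\binom{k}{j}\sum_{i_1+\cdots+i_k=n-1}\int_0^s\mathcal{M}_{i_1}(\cdots)(t_n)\cdots\mathcal{M}_{i_j}(\cdots)(t_n)\,a_{p_j+1}(t_n)\,\mathcal{M}_{i_{j+1}}(\cdots)(t_n)\cdots\mathcal{M}_{i_k}(\cdots)(t_n)\,dt_n .$$ Here $i_1,\dots,i_k\ge1$, $p_j=\sum_{h\le j}i_h$ (so $p_0=0$), and the dots inside parentheses are filled by the arguments in the order $a_1,\dots,a_n$: thus $\mathcal{M}_{i_1},\dots,\mathcal{M}_{i_j}$ receive successive blocks of $a_1,\dots,a_{p_j}$, and $\mathcal{M}_{i_{j+1}},\dots,\mathcal{M}_{i_k}$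 receive successive blocks of $a_{p_j+2},\dots,a_n$.
   Context: **$A_\infty$ conventions.** $\Bbbk$ is a field of characteristic zero. For a graded vector space $V$, $\mathbf{s}V$ is the suspension (bold $\mathbf{s}$, not to be confused with the parameter $s$), $(\mathbf{s}V)^i=V^{i+1}$. $\overline{T}(V)=\bigoplus_{n\ge1}V^{\otimes n}$ carries the deconcatenation coproduct. An $A_\infty$ algebra structure on $V$ is a degree $1$ coderivation $Q$ of $\overline{T}(\mathbf{s}V)$ with $Q^2=0$; it is determined by its Taylor coefficients $Q_n:(\mathbf{s}V)^{\otimes n}\to\mathbf{s}V$. An $A_\infty$ morphism $F:V\to W$ is a morphism of dg coalgebras $\overline{T}(\mathbf{s}V)\to\overline{T}(\mathbf{s}W)$, determined by its Taylor coefficients $F_n:(\mathbf{s}V)^{\otimes n}\to\mathbf{s}W$; the composition has coefficients $(G\circ F)_n=\sum_{k}\sum_{i_1+\cdots+i_k=n}G_k(F_{i_1}\otimes\cdots\otimes F_{i_k})$. A dg algebra is an $A_\infty$ algebra via $Q_1(\mathbf{s}a)=-\mathbf{s}(da)$, $Q_2(\mathbf{s}a\otimes\mathbf{s}b)=(-1)^{|a|}\mathbf{s}(ab)$, $Q_n=0$ for $n\ge3$. $C_\infty$ algebras/morphisms are $A_\infty$ algebras/morphisms whose Taylor coefficients vanish on shuffle products. **Forms and cochains.** $\Omega^*([0,1])$ is either the commutative dg algebra of smooth real forms on $[0,1]$ ($\Bbbk=\mathbb{R}$, and the parameter $s\in[0,1]$) or that of polynomial forms $\Bbbk[t]\oplus\Bbbk[t]dt$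 ($s\in\Bbbk$, integrals evaluated formally). $\beta_s^*$ is the dg algebra endomorphism of $\Omega^*([0,1])$ given by pullback: $f(t)\mapsto f(st)$, $a(t)dt\mapsto s\,a(st)dt$. $C^*([0,1])\subset\Omega^*([0,1])$ is the subcomplex of Whitney forms $\{at+b(1-t)\}\oplus\{c\,dt\}$, $a,b,c\in\Bbbk$. $C^*_\cup([0,1])$ is the dg algebra $(C^*([0,1]),d,\cup)$ with unit the constant function $1$ and $t\cup t=t$, $t\cup dt=0$, $dt\cup t=dt$. $C^*_\infty([0,1])$ is $C^*([0,1])$ with the $C_\infty$ structure, unital with respect to $1$, with Taylor coefficients: $m_1(\mathbf{s}t)=-\mathbf{s}dt$, $m_2(\mathbf{s}t\otimes\mathbf{s}t)=\mathbf{s}t$, $m_2(\mathbf{s}t\otimes\mathbf{s}dt)=\frac12\mathbf{s}dt=-m_2(\mathbf{s}dt\otimes\mathbf{s}t)$, and for $n>1$, $m_{n+1}$ vanishes unless precisely one argument is a function, with $m_{n+1}((\mathbf{s}dt)^{\otimes i}\otimes\mathbf{s}t\otimes(\mathbf{s}dt)^{\otimes n-i})=(-1)^{i+1}\binom{n}{i}\frac{B_n}{n!}\mathbf{s}dt$. The Bernoulli numbers are defined by $\frac{z}{e^z-1}=\sum_{n\ge0}\frac{B_n}{n!}z^n$. **The morphism $\lambda$** is the $A_\infty$ morphism $\Omega^*([0,1])\to C^*_\cup([0,1])$ with $\lambda_1=\pi$, where $\pi(f)=f(1)t+f(0)(1-t)$ on functions and $\pi(a(t)dt)=\left(\int_0^1a(\tau)d\tau\right)dt$;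 for $n>1$, $\lambda_n$ vanishes if some factor is a zero-form; and $\lambda_n(\mathbf{s}a_1(t)dt\otimes\cdots\otimes\mathbf{s}a_n(t)dt)=\left(\int_{0\le t_1\le\cdots\le t_n\le1}a_1(t_1)\cdots a_n(t_n)dt_1\cdots dt_n\right)\mathbf{s}dt$ for $n\ge1$. **The morphism $\log$** is the $A_\infty$ isomorphism $C^*_\cup([0,1])\to C^*_\infty([0,1])$ with $\log_1=\mathrm{id}$, $\log_n$ ($n>1$) vanishing if some factor is a zero-form, and $\log_n((\mathbf{s}dt)^{\otimes n})=\frac{(-1)^{n+1}}{n}\mathbf{s}dt$ for $n\ge1$. *)

theory Defs
  imports "HOL-Analysis.Analysis" "HOL-Computational_Algebra.Computational_Algebra"
begin

section \<open>Taylor coefficients and their composition\<close>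

text \<open>
  An \<open>A\<^sub>\<infinity>\<close> morphism \<open>F : V \<rightarrow> W\<close> is determined by its Taylor coefficients
  \<open>F\<^sub>n : (sV)\<^sup>\<otimes>\<^sup>n \<rightarrow> sW\<close>. The whole family is encoded as one function on lists: the value of
  \<open>F\<^sub>n\<close> on \<open>s v\<^sub>1 \<otimes> \<dots> \<otimes> s v\<^sub>n\<close> is \<open>F [v\<^sub>1, \<dots>, v\<^sub>n]\<close> (multilinear in the entries). The suspension
  only shifts degrees, so \<open>v\<close> and \<open>s v\<close> have the same representation. The value at the empty
  list is irrelevant, because the reduced tensor coalgebra starts in length one. All \<open>F\<^sub>n\<close> have
  degree zero, so no Koszul signs occur in compositions.
\<close>

definition compositions :: "nat \<Rightarrow> nat \<Rightarrow> nat list set" where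
  "compositions k n = {is. length is = k \<and> sum_list is = n \<and> (\<forall>i\<in>set is. 1 \<le> i)}"

fun blocks :: "nat list \<Rightarrow> 'a list \<Rightarrow> 'a list list" where
  "blocks [] xs = []"
| "blocks (i # is) xs = take i xs # blocks is (drop i xs)"

definition taylor_comp ::
    "('b list \<Rightarrow> 'c::comm_monoid_add) \<Rightarrow> ('a list \<Rightarrow> 'b) \<Rightarrow> 'a list \<Rightarrow> 'c" where
  "taylor_comp G F xs =
     (\<Sum>k = 1..length xs. \<Sum>is\<in>compositions k (length xs). G (map F (blocks is xs)))"

lemma set_blocks_length_le:
  "b \<in> set (blocks is xs) \<Longrightarrow> length b \<le> length xs"
  by (induction "is" xs rule: blocks.induct) (auto intro: order_trans)


section \<open>Whitney forms and the morphism log\<close>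

text \<open>The triple \<open>(a, b, c)\<close> is the Whitney form \<open>a t + b (1 - t) + c dt\<close>.\<close>

type_synonym 'k whitney = "'k \<times> 'k \<times> 'k"

definition whitney_dt :: "'k::zero \<Rightarrow> 'k whitney" where
  "whitney_dt c = (0, 0, c)"

fun dt_coeff :: "'k whitney \<Rightarrow> 'k" where
  "dt_coeff (a, b, c) = c"

text \<open>
  The coefficients of order \<open>n > 1\<close> vanish if some factor is a zero-form, hence by
  multilinearity they depend on the \<open>dt\<close>-components only. The same applies to the morphism
  \<open>\<lambda>\<close> below.
\<close>

fun log_coeff :: "'k::field_char_0 whitney list \<Rightarrow> 'k whitney" where
  "log_coeff [] = 0"
| "log_coeff [w] = w"
| "log_coeff ws = whitney_dt
     ((-1) ^ (length ws + 1) / of_nat (length ws) * (\<Prod>w\<leftarrow>ws. dt_coeff w))"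


section \<open>Bernoulli numbers\<close>

definition bernoulli_num :: "nat \<Rightarrow> 'k::field_char_0" where
  "bernoulli_num n = fact n * fps_nth (fps_X / (fps_exp 1 - 1)) n"


section \<open>Smooth forms\<close>

text \<open>
  Smooth functions on the closed interval, with one-sided derivatives of all orders at the
  end points; values outside \<open>[0,1]\<close> are irrelevant.
\<close>

definition smooth01 :: "(real \<Rightarrow> real) set" where
  "smooth01 = {f. \<exists>D :: nat \<Rightarrow> real \<Rightarrow> real. D 0 = f \<and>
     (\<forall>n. \<forall>x\<in>{0..1}. (D n has_real_derivative D (Suc n) x) (at x within {0..1}))}"

text \<open>The pair \<open>(f, a)\<close> is the form \<open>f(t) + a(t) dt\<close>.\<close>

type_synonym smooth_form = "(real \<Rightarrow> real) \<times> (real \<Rightarrow> real)"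

definition smooth_one_form :: "(real \<Rightarrow> real) \<Rightarrow> smooth_form" where
  "smooth_one_form a = ((\<lambda>_. 0), a)"

fun smooth_pi :: "smooth_form \<Rightarrow> real whitney" where
  "smooth_pi (f, a) = (f 1, f 0, integral {0..1} a)"

text \<open>The simplex \<open>0 \<le> t\<^sub>1 \<le> \<dots> \<le> t\<^sub>n \<le> 1\<close>, with the coordinates numbered from zero.\<close>

definition ordered_simplex :: "nat \<Rightarrow> (nat \<Rightarrow> real) set" where
  "ordered_simplex n = {t. (\<forall>i<n. 0 \<le> t i \<and> t i \<le> 1) \<and> (\<forall>i j. i \<le> j \<and> j < n \<longrightarrow> t i \<le> t j)}"

definition smooth_simplex_integral :: "(real \<Rightarrow> real) list \<Rightarrow> real" where
  "smooth_simplex_integral as =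
     (LINT t : ordered_simplex (length as) | PiM {..<length as} (\<lambda>_. lborel).
        (\<Prod>i<length as. (as ! i) (t i)))"

fun smooth_lambda :: "smooth_form list \<Rightarrow> real whitney" where
  "smooth_lambda [] = 0"
| "smooth_lambda [\<omega>] = smooth_pi \<omega>"
| "smooth_lambda \<omega>s = whitney_dt (smooth_simplex_integral (map snd \<omega>s))"

text \<open>
  The pullback along \<open>t \<mapsto> s t\<close> is a morphism of dg algebras, i.e. a strict \<open>A\<^sub>\<infinity>\<close> morphism: its
  Taylor coefficients of order \<open>n > 1\<close> vanish.
\<close>

fun smooth_pullback :: "real \<Rightarrow> smooth_form list \<Rightarrow> smooth_form" where
  "smooth_pullback s [(f, a)] = ((\<lambda>t. f (s * t)), (\<lambda>t. s * a (s * t)))"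
| "smooth_pullback s _ = ((\<lambda>_. 0), (\<lambda>_. 0))"

definition smooth_phi :: "smooth_form list \<Rightarrow> real whitney" where
  "smooth_phi = taylor_comp log_coeff smooth_lambda"

definition smooth_phi_s :: "real \<Rightarrow> smooth_form list \<Rightarrow> real whitney" where
  "smooth_phi_s s = taylor_comp smooth_phi (smooth_pullback s)"

text \<open>
  In the recursion, \<open>p = p\<^sub>j\<close>, the entry \<open>as ! p\<close> (numbered from zero) is \<open>a\<close> with index
  \<open>p\<^sub>j + 1\<close>, and the lists before and after it are cut into the first \<open>j\<close> and the
  last \<open>k - j\<close> blocks.
\<close>

function smooth_M :: "(real \<Rightarrow> real) list \<Rightarrow> real \<Rightarrow> real" where
  "smooth_M as s =
     (if length as = 0 then 0
      else if length as = 1 then integral {0..s} (hd as)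
      else (\<Sum>k = 1..length as - 1. bernoulli_num k / fact k *
             (\<Sum>j = 0..k. (-1) ^ j * of_nat (k choose j) *
               (\<Sum>is\<in>compositions k (length as - 1).
                 let p = sum_list (take j is) in
                 integral {0..s} (\<lambda>t.
                   (\<Prod>b\<leftarrow>blocks (take j is) (take p as). smooth_M b t) *
                   (as ! p) t *
                   (\<Prod>b\<leftarrow>blocks (drop j is) (drop (Suc p) as). smooth_M b t))))))"
  by auto
termination
proof (relation "Wellfounded.measure (\<lambda>(as, s). length as)", goal_cases)
  case 1
  show ?case by simp
next
  case (2 as s k j "is" p t b)
  have "sum_list (take j is) + sum_list (drop j is) = sum_list is"
    by (metis append_take_drop_id sum_list_append)
  with 2 set_blocks_length_le[of b "take j is" "take p as"] show ?case
    by (auto simp: compositions_def)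
next
  case (3 as s k j "is" p t b)
  with set_blocks_length_le[of b "drop j is" "drop (Suc p) as"] show ?case
    by auto
qed

declare smooth_M.simps [simp del]


section \<open>Polynomial forms\<close>

text \<open>The pair \<open>(f, a)\<close> is the form \<open>f(t) + a(t) dt\<close>.\<close>

type_synonym 'k poly_form = "'k poly \<times> 'k poly"

text \<open>The formal integral \<open>\<integral>\<^sub>0\<^sup>t p(\<tau>) d\<tau>\<close>, as a polynomial in \<open>t\<close>.\<close>

definition poly_integral0 :: "'k::field_char_0 poly \<Rightarrow> 'k poly" where
  "poly_integral0 p = (\<Sum>i\<le>degree p. monom (coeff p i / of_nat (Suc i)) (Suc i))"

definition poly_one_form :: "'k::zero poly \<Rightarrow> 'k poly_form" where
  "poly_one_form a = (0, a)"

fun poly_pi :: "'k::field_char_0 poly_form \<Rightarrow> 'k whitney" where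
  "poly_pi (f, a) = (poly f 1, poly f 0, poly (poly_integral0 a) 1)"

text \<open>
  Formal evaluation of the integral over \<open>0 \<le> t\<^sub>1 \<le> \<dots> \<le> t\<^sub>n \<le> 1\<close> as an iterated integral; the
  innermost integration is that of \<open>a\<^sub>1(t\<^sub>1)\<close> over \<open>0 \<le> t\<^sub>1 \<le> t\<^sub>2\<close>.
\<close>

definition poly_simplex_integral :: "'k::field_char_0 poly list \<Rightarrow> 'k" where
  "poly_simplex_integral as = poly (foldl (\<lambda>q a. poly_integral0 (q * a)) 1 as) 1"

fun poly_lambda :: "'k::field_char_0 poly_form list \<Rightarrow> 'k whitney" where
  "poly_lambda [] = 0"
| "poly_lambda [\<omega>] = poly_pi \<omega>"
| "poly_lambda \<omega>s = whitney_dt (poly_simplex_integral (map snd \<omega>s))"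

fun poly_pullback :: "'k::field_char_0 \<Rightarrow> 'k poly_form list \<Rightarrow> 'k poly_form" where
  "poly_pullback s [(f, a)] = (pcompose f [:0, s:], smult s (pcompose a [:0, s:]))"
| "poly_pullback s _ = (0, 0)"

definition poly_phi :: "'k::field_char_0 poly_form list \<Rightarrow> 'k whitney" where
  "poly_phi = taylor_comp log_coeff poly_lambda"

definition poly_phi_s :: "'k::field_char_0 \<Rightarrow> 'k poly_form list \<Rightarrow> 'k whitney" where
  "poly_phi_s s = taylor_comp poly_phi (poly_pullback s)"

function poly_M :: "'k::field_char_0 poly list \<Rightarrow> 'k poly" where
  "poly_M as =
     (if length as = 0 then 0
      else if length as = 1 then poly_integral0 (hd as)
      else (\<Sum>k = 1..length as - 1. smult (bernoulli_num k / fact k)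
             (\<Sum>j = 0..k. smult ((-1) ^ j * of_nat (k choose j))
               (\<Sum>is\<in>compositions k (length as - 1).
                 let p = sum_list (take j is) in
                 poly_integral0
                   ((\<Prod>b\<leftarrow>blocks (take j is) (take p as). poly_M b) *
                    (as ! p) *
                    (\<Prod>b\<leftarrow>blocks (drop j is) (drop (Suc p) as). poly_M b))))))"
  by auto
termination
proof (relation "Wellfounded.measure length", goal_cases)
  case 1
  show ?case by simp
next
  case (2 as k j "is" p b)
  have "sum_list (take j is) + sum_list (drop j is) = sum_list is"
    by (metis append_take_drop_id sum_list_append)
  with 2 set_blocks_length_le[of b "take j is" "take p as"] show ?case
    by (auto simp: compositions_def)
next
  case (3 as k j "is" p b)
  with set_blocks_length_le[of b "drop j is" "drop (Suc p) as"] show ?case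
    by auto
qed

declare poly_M.simps [simp del]

end

theory Submission
  imports Defs
begin

text \<open>
  Fix letters \<open>a\<^sub>1, a\<^sub>2, \<dots>\<close> and let \<open>I(s)\<close> be the function on words whose value at
  \<open>a\<^sub>1 \<dots> a\<^sub>n\<close> is the integral of \<open>a\<^sub>1(t\<^sub>1) \<dots> a\<^sub>n(t\<^sub>n)\<close> over \<open>0 \<le> t\<^sub>1 \<le> \<dots> \<le> t\<^sub>n \<le> s\<close>.
  Functions on words form an algebra under convolution along deconcatenation, and there
  \<open>I' = I A\<close>, with \<open>A\<close> supported on words of length one, because the last variable is the
  outermost one. Composing the coefficients of \<open>log\<close> and \<open>\<lambda>\<close> means taking the logarithm in
  this algebra, and pulling back along \<open>t \<mapsto> s t\<close> changes the upper end of integration from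
  \<open>1\<close> to \<open>s\<close>. So the coefficients of \<open>\<phi>\<^sub>s\<close> on one-forms are the values of \<open>M(s) = log I(s)\<close>.

  The recursion is then the Magnus equation
  \<open>M' = (\<Sum>k. B\<^sub>k / k! (- ad M)\<^sup>k) A\<close>, expanded by
  \<open>(- ad M)\<^sup>k A = (\<Sum>j\<le>k. (-1)\<^sup>j (k choose j) M\<^sup>j A M\<^sup>k\<^sup>-\<^sup>j)\<close> and integrated from \<open>0\<close>.
  To prove it, put \<open>I = 1 + P\<close>. Differentiating \<open>log (1 + P)\<close> term by term gives a combination
  of the products \<open>P\<^sup>i A P\<^sup>j\<close>, and so does the right-hand side, because \<open>M\<close> is a power series in
  \<open>P\<close>. Left and right multiplication by \<open>P\<close> commute, so the claim is an identity in two
  commuting variables,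
  \<open>B(log (1 + y) - log (1 + x)) = (1 + x) (log (1 + y) - log (1 + x)) / (y - x)\<close> with
  \<open>B(z) = z / (e\<^sup>z - 1)\<close>. It is proved for coefficients in \<open>bernoulli_kernel_ln_coeff\<close>, turned into
  an identity for convolution powers in \<open>conv_series_ln_kernel\<close>, and combined with the Leibniz
  rule in \<open>deriv_log\<close> and \<open>magnus_recursion\<close>.

  Polynomials and smooth functions share this argument through an abstract notion of
  derivative. What is specific to smooth forms is that the Lebesgue integral over the simplex is
  an iterated integral, by Fubini's theorem.
\<close>

unbundle no vec_syntax

section \<open>A coefficient identity for Bernoulli numbers and the logarithm\<close>

lemma bernoulli_num_fps: "bernoulli_num n / fact n = (fps_X / (fps_exp 1 - 1) :: 'k::field_char_0 fps) $ n"
  by (simp add: bernoulli_num_def)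

text \<open>
  Under the substitution \<open>z = log (1 + y)\<close> the denominator of \<open>z / (e\<^sup>z - 1)\<close> becomes \<open>y\<close>.
\<close>

lemma bernoulli_compose_ln_nth:
  "((fps_X / (fps_exp 1 - 1)) oo fps_ln (1::'k::field_char_0)) $ j = (-1) ^ j / of_nat (Suc j)"
proof -
  let ?E = "fps_exp 1 - 1 :: 'k fps" and ?L = "fps_ln 1 :: 'k fps"
  have E0: "?E $ 0 = 0" and E1: "?E $ 1 \<noteq> 0" by simp_all
  have nz: "?E \<noteq> 0" using E1 by force
  have dvd: "?E dvd fps_X"
    using nz by (subst fps_dvd_iff) (auto intro!: subdegree_leI)
  have EL: "?E oo ?L = fps_X"
    using fps_inv_right[OF E0 E1] by (simp add: fps_ln_fps_exp_inv)
  have "?L = fps_X oo ?L" by (simp add: fps_ln_0)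
  also have "fps_X oo ?L = (fps_X / ?E oo ?L) * (?E oo ?L)"
    by (rule fps_compose_divide[OF dvd]) (simp add: fps_ln_0)
  finally have "?L = (fps_X / ?E oo ?L) * fps_X" unfolding EL .
  then have "?L $ Suc j = ((fps_X / ?E oo ?L) * fps_X) $ Suc j" by simp
  then show ?thesis by (simp add: fps_ln_nth)
qed

lemma fps_ln_power_nth_eq_0: "i < m \<Longrightarrow> (fps_ln (1::'k::field_char_0) ^ m) $ i = 0"
  by (rule startsby_zero_power_prefix[rule_format]) (auto simp: fps_ln_0)

text \<open>
  The coefficients of \<open>(1 + x) (d/dx) log (1 + x)\<^sup>m = m log (1 + x)\<^sup>m\<^sup>-\<^sup>1\<close>.
\<close>

lemma fps_ln_power_rec:
  "of_nat (Suc i) * (fps_ln (1::'k::field_char_0) ^ m) $ Suc i + of_nat i * (fps_ln 1 ^ m) $ i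
     = of_nat m * (fps_ln 1 ^ (m - 1)) $ i"
proof -
  let ?L = "fps_ln 1 :: 'k fps"
  have D: "(1 + fps_X) * fps_deriv (?L ^ m) = of_nat m * ?L ^ (m - 1)"
  proof -
    have inv: "(1 + fps_X :: 'k fps) * inverse (1 + fps_X) = 1"
      by (rule inverse_mult_eq_1') simp
    have "(1 + fps_X) * fps_deriv (?L ^ m)
        = of_nat m * ((1 + fps_X) * inverse (1 + fps_X)) * ?L ^ (m - 1)"
      by (simp add: fps_deriv_power fps_ln_deriv fps_of_nat)
    then show ?thesis unfolding inv by simp
  qed
  have "((1 + fps_X) * fps_deriv (?L ^ m)) $ i = (of_nat m * ?L ^ (m - 1)) $ i"
    using D by simp
  then show ?thesis
    by (cases i) (simp_all add: distrib_right fps_of_nat[symmetric])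
qed

text \<open>
  The coefficient of \<open>x\<^sup>m y\<^sup>q\<close> in \<open>B(y - x)\<close>, where \<open>B(z) = z / (e\<^sup>z - 1)\<close>.
\<close>

definition bernoulli_kernel :: "nat \<Rightarrow> nat \<Rightarrow> 'k::field_char_0" where
  "bernoulli_kernel m q = (-1) ^ m * bernoulli_num (m + q) / (fact m * fact q)"

text \<open>
  A function of \<open>y - x\<close> is annihilated by \<open>\<partial>\<^sub>x + \<partial>\<^sub>y\<close>.
\<close>

lemma bernoulli_kernel_rec:
  "of_nat (Suc m) * bernoulli_kernel (Suc m) q = - of_nat (Suc q) * bernoulli_kernel m (Suc q)"
  by (simp add: bernoulli_kernel_def divide_simps del: of_nat_Suc)

lemma bernoulli_kernel_binomial:
  assumes "m \<le> k"
  shows "bernoulli_kernel m (k - m) = bernoulli_num k / fact k * ((-1) ^ m * of_nat (k choose m))"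
  using assms by (simp add: bernoulli_kernel_def binomial_fact)

text \<open>
  Both sides are the coefficient of \<open>x\<^sup>i y\<^sup>j\<close> in
  \<open>B(log (1 + y) - log (1 + x)) = (1 + x) (log (1 + y) - log (1 + x)) / (y - x)\<close>.
  The vector field \<open>(1 + x) \<partial>\<^sub>x + (1 + y) \<partial>\<^sub>y\<close> annihilates the left-hand side, which determines
  the coefficients in row \<open>i + 1\<close> from those in row \<open>i\<close>; the row \<open>i = 0\<close> is the series
  \<open>log (1 + y) / y\<close>. The right-hand side satisfies the same recursion. Working with
  coefficients keeps all sums finite, since \<open>log (1 + x)\<^sup>m\<close> starts at \<open>x\<^sup>m\<close>.
\<close>

lemma bernoulli_kernel_ln_coeff:
  fixes i j :: nat
  defines "\<And>m i. l m i \<equiv> (fps_ln (1::'k::field_char_0) ^ m) $ i"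
  shows "(\<Sum>m\<le>i. \<Sum>q\<le>j. bernoulli_kernel m q * l m i * l q j) =
           (-1) ^ (i + j) / of_nat (Suc (i + j)) +
             (if i = 0 then 0 else (-1) ^ Suc (i + j) / of_nat (i + j))"
proof -
  define R where "R i j = (\<Sum>m\<le>i. \<Sum>q\<le>j. bernoulli_kernel m q * l m i * l q j)" for i j
  have l0: "l m i = 0" if "i < m" for m i
    using that by (simp add: l_def fps_ln_power_nth_eq_0)
  have lrec: "of_nat (Suc i) * l m (Suc i) + of_nat i * l m i = of_nat m * l (m - 1) i" for m i
    unfolding l_def by (rule fps_ln_power_rec)
  \<comment> \<open>The summation range may be enlarged, so that sums in neighbouring rows and columns can be
      added term by term.\<close>
  have R_big: "R i j = (\<Sum>m\<le>a. \<Sum>q\<le>b. bernoulli_kernel m q * l m i * l q j)"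
    if "i \<le> a" "j \<le> b" for i j a b
  proof -
    have "(\<Sum>m\<le>a. \<Sum>q\<le>b. bernoulli_kernel m q * l m i * l q j)
        = (\<Sum>m\<le>i. \<Sum>q\<le>b. bernoulli_kernel m q * l m i * l q j)"
      using that by (intro sum.mono_neutral_right) (auto simp: l0)
    also have "\<dots> = R i j"
      unfolding R_def using that by (intro sum.cong refl sum.mono_neutral_right) (auto simp: l0)
    finally show ?thesis by simp
  qed
  \<comment> \<open>\<open>first\<close> and \<open>second\<close> are the effects of \<open>(1 + x) \<partial>\<^sub>x\<close> and \<open>(1 + y) \<partial>\<^sub>y\<close>; they cancel by
      \<open>bernoulli_kernel_rec\<close>.\<close>
  have first: "of_nat (Suc i) * R (Suc i) j + of_nat i * R i j =
       (\<Sum>m\<le>i. \<Sum>q\<le>j. of_nat (Suc m) * bernoulli_kernel (Suc m) q * l m i * l q j)" for i j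
  proof -
    have "of_nat (Suc i) * R (Suc i) j + of_nat i * R i j =
       (\<Sum>m\<le>Suc i. \<Sum>q\<le>j. bernoulli_kernel m q * (of_nat (Suc i) * l m (Suc i) + of_nat i * l m i) * l q j)"
      unfolding R_big[OF le_refl[of "Suc i"] le_refl[of j]] R_big[OF le_SucI[OF le_refl[of i]] le_refl[of j]]
      by (simp only: sum_distrib_left sum.distrib[symmetric]) (simp add: algebra_simps)
    also have "\<dots> = (\<Sum>m\<le>Suc i. \<Sum>q\<le>j. bernoulli_kernel m q * (of_nat m * l (m - 1) i) * l q j)"
      unfolding lrec ..
    also have "\<dots> = (\<Sum>m\<le>i. \<Sum>q\<le>j. bernoulli_kernel (Suc m) q * (of_nat (Suc m) * l m i) * l q j)"
      by (subst sum.atMost_Suc_shift) simp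
    finally show ?thesis by (simp add: mult_ac)
  qed
  have second: "of_nat (Suc j) * R i (Suc j) + of_nat j * R i j =
       (\<Sum>m\<le>i. \<Sum>q\<le>j. of_nat (Suc q) * bernoulli_kernel m (Suc q) * l m i * l q j)" for i j
  proof -
    have "of_nat (Suc j) * R i (Suc j) + of_nat j * R i j =
       (\<Sum>m\<le>i. \<Sum>q\<le>Suc j. bernoulli_kernel m q * l m i * (of_nat (Suc j) * l q (Suc j) + of_nat j * l q j))"
      unfolding R_big[OF le_refl[of i] le_refl[of "Suc j"]] R_big[OF le_refl[of i] le_SucI[OF le_refl[of j]]]
      by (simp only: sum_distrib_left sum.distrib[symmetric]) (simp add: algebra_simps)
    also have "\<dots> = (\<Sum>m\<le>i. \<Sum>q\<le>Suc j. bernoulli_kernel m q * l m i * (of_nat q * l (q - 1) j))"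
      unfolding lrec ..
    also have "\<dots> = (\<Sum>m\<le>i. \<Sum>q\<le>j. bernoulli_kernel m (Suc q) * l m i * (of_nat (Suc q) * l q j))"
      by (subst sum.atMost_Suc_shift) simp
    finally show ?thesis by (simp add: mult_ac)
  qed
  have R_rec: "of_nat (Suc i) * R (Suc i) j = - (of_nat i * R i j + of_nat (Suc j) * R i (Suc j) + of_nat j * R i j)" for i j
  proof -
    have "(of_nat (Suc i) * R (Suc i) j + of_nat i * R i j) + (of_nat (Suc j) * R i (Suc j) + of_nat j * R i j) = 0"
      unfolding first second by (simp add: bernoulli_kernel_rec sum_negf del: of_nat_Suc)
    then show ?thesis by (simp add: algebra_simps eq_neg_iff_add_eq_0)
  qed
  have R0: "R 0 j = (-1) ^ j / of_nat (Suc j)" for j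
  proof -
    have "R 0 j = (\<Sum>q\<le>j. bernoulli_num q / fact q * l q j)"
      by (simp add: R_def bernoulli_kernel_def l_def)
    also have "\<dots> = ((fps_X / (fps_exp 1 - 1)) oo fps_ln (1::'k)) $ j"
      by (simp add: fps_compose_nth bernoulli_num_fps l_def atMost_atLeast0)
    finally show ?thesis by (simp add: bernoulli_compose_ln_nth)
  qed
  have "R i j = (-1) ^ (i + j) / of_nat (Suc (i + j)) +
             (if i = 0 then 0 else (-1) ^ Suc (i + j) / of_nat (i + j))" for i j
  proof (induction i arbitrary: j)
    case 0
    then show ?case by (simp add: R0)
  next
    case (Suc i)
    show ?case
    proof (cases "i = 0")
      case True
      let ?x = "of_nat j :: 'k"
      have nz: "?x + 1 \<noteq> 0" "?x + 2 \<noteq> 0"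
        using of_nat_neq_0[of j, where 'a='k] of_nat_neq_0[of "Suc j", where 'a='k] by (simp_all add: add_ac)
      have "R (Suc 0) j = - (of_nat (Suc j) * R 0 (Suc j) + of_nat j * R 0 j)"
        using R_rec[of 0 j] by simp
      also have "\<dots> = (-1) ^ j * ((?x + 1) / (?x + 2) - ?x / (?x + 1))"
        by (simp add: R0 algebra_simps)
      also have "(?x + 1) / (?x + 2) - ?x / (?x + 1) = 1 / (?x + 1) - 1 / (?x + 2)"
        using nz by (simp add: divide_simps) (simp add: algebra_simps)
      finally show ?thesis using True by (simp add: algebra_simps)
    next
      case False
      let ?n = "of_nat (i + j) :: 'k"
      have nz: "?n \<noteq> 0" "?n + 1 \<noteq> 0" "?n + 2 \<noteq> 0"
        using False of_nat_neq_0[of "i + j", where 'a='k] of_nat_neq_0[of "Suc (i + j)", where 'a='k]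
        by (simp_all add: add_ac of_nat_eq_0_iff flip: of_nat_add)
      have si: "of_nat (Suc i) \<noteq> (0::'k)" by (rule of_nat_neq_0)
      have e: "(R i j) = (-1) ^ (i + j) * (1 / (?n + 1) - 1 / ?n)"
        using False by (simp add: Suc.IH algebra_simps)
      have e': "R i (Suc j) = (-1) ^ (i + j) * (1 / (?n + 1) - 1 / (?n + 2))"
        using False by (simp add: Suc.IH algebra_simps)
      have "of_nat (Suc i) * R (Suc i) j = - (?n * R i j + of_nat (Suc j) * R i (Suc j))"
        unfolding R_rec by (simp add: algebra_simps)
      also have "\<dots> = of_nat (Suc i) * ((-1) ^ (i + j) * (1 / (?n + 1) - 1 / (?n + 2)))"
      proof -
        have "- (?n * (1 / (?n + 1) - 1 / ?n) + of_nat (Suc j) * (1 / (?n + 1) - 1 / (?n + 2)))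
            = (?n + 1 - of_nat j) * (1 / (?n + 1) - 1 / (?n + 2))"
          using nz by (simp add: divide_simps)
        also have "?n + 1 - of_nat j = of_nat (Suc i)" by simp
        finally have "- (?n * (1 / (?n + 1) - 1 / ?n) + of_nat (Suc j) * (1 / (?n + 1) - 1 / (?n + 2)))
            = of_nat (Suc i) * (1 / (?n + 1) - 1 / (?n + 2))" .
        from arg_cong[OF this, of "\<lambda>x. (-1) ^ (i + j) * x"]
        show ?thesis unfolding e e' by (simp only: distrib_left mult_minus_right mult.left_commute[of "(-1) ^ (i + j)"])
      qed
      finally have "R (Suc i) j = (-1) ^ (i + j) * (1 / (?n + 1) - 1 / (?n + 2))"
        using si by simp
      then show ?thesis by (simp add: algebra_simps)
    qed
  qed
  then show ?thesis by (simp only: R_def)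
qed

section \<open>Compositions and the convolution algebra of functions on words\<close>

lemma finite_compositions: "finite (compositions k n)"
proof (rule finite_subset)
  show "compositions k n \<subseteq> {is. set is \<subseteq> {..n} \<and> length is = k}"
    by (auto simp: compositions_def intro: member_le_sum_list)
qed (simp add: finite_lists_length_eq)

lemma compositions_0: "compositions 0 n = (if n = 0 then {[]} else {})"
  by (auto simp: compositions_def)

lemma compositions_1: "compositions (Suc 0) n = (if n = 0 then {} else {[n]})"
  by (auto simp: compositions_def length_Suc_conv)

lemma compositions_empty:
  assumes "n < k"
  shows "compositions k n = {}"
proof -
  have "length is \<le> sum_list is" if "\<forall>i\<in>set is. 1 \<le> i" for "is" :: "nat list"
    using that by (induction "is") (auto simp: Suc_le_eq add_le_mono)
  with assms show ?thesis by (fastforce simp: compositions_def)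
qed

text \<open>
  Cutting a composition after its \<open>j\<close>-th part; \<open>p\<close> is the sum of the parts before the cut.
\<close>

lemma sum_compositions_add:
  "(\<Sum>is\<in>compositions (j + k) n. g (take j is) (drop j is)) =
   (\<Sum>p\<le>n. \<Sum>us\<in>compositions j p. \<Sum>vs\<in>compositions k (n - p). g us vs)"
proof -
  have "(\<Sum>p\<le>n. \<Sum>us\<in>compositions j p. \<Sum>vs\<in>compositions k (n - p). g us vs)
      = (\<Sum>(p, us, vs)\<in>(SIGMA p:{..n}. compositions j p \<times> compositions k (n - p)). g us vs)"
    by (simp add: sum.Sigma finite_compositions sum.cartesian_product)
  also have "\<dots> = (\<Sum>is\<in>compositions (j + k) n. g (take j is) (drop j is))"
  proof (rule sum.reindex_bij_witness[where j = "\<lambda>(p, us, vs). us @ vs"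
        and i = "\<lambda>is. (sum_list (take j is), take j is, drop j is)"], goal_cases)
    case (4 "is")
    have "sum_list (take j is) + sum_list (drop j is) = sum_list is"
      by (metis append_take_drop_id sum_list_append)
    with 4 show ?case by (auto simp: compositions_def dest: in_set_takeD in_set_dropD)
  qed (auto simp: compositions_def)
  finally show ?thesis by simp
qed

lemma blocks_append:
  "blocks (us @ vs) xs =
     blocks us (take (sum_list us) xs) @ blocks vs (drop (sum_list us) xs)"
  by (induction us arbitrary: xs) (simp_all add: drop_take add.commute min_def)

lemma set_block_subset: "b \<in> set (blocks is xs) \<Longrightarrow> set b \<subseteq> set xs"
  by (induction "is" xs rule: blocks.induct) (auto dest: in_set_takeD in_set_dropD)

lemma blocks_map: "blocks is (map f xs) = map (map f) (blocks is xs)"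
  by (induction "is" xs rule: blocks.induct) (simp_all add: take_map drop_map)

text \<open>
  The \<open>k\<close>-th power of \<open>F\<close> under convolution along deconcatenation, with \<open>F\<close> regarded as zero on
  the empty word: all blocks are nonempty.
\<close>

definition conv_power :: "('a list \<Rightarrow> 'k::comm_semiring_1) \<Rightarrow> nat \<Rightarrow> 'a list \<Rightarrow> 'k" where
  "conv_power F k xs = (\<Sum>is\<in>compositions k (length xs). \<Prod>b\<leftarrow>blocks is xs. F b)"

lemma conv_power_0: "conv_power F 0 xs = (if xs = [] then 1 else 0)"
  by (simp add: conv_power_def compositions_0)

lemma conv_power_1: "conv_power F (Suc 0) xs = (if xs = [] then 0 else F xs)"
  by (simp add: conv_power_def compositions_1)

lemma conv_power_eq_0: "length xs < k \<Longrightarrow> conv_power F k xs = 0"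
  by (simp add: conv_power_def compositions_empty)

lemma conv_power_cong:
  assumes "\<And>b. length b \<le> length xs \<Longrightarrow> set b \<subseteq> set xs \<Longrightarrow> F b = G b"
  shows "conv_power F k xs = conv_power G k xs"
  unfolding conv_power_def
  by (intro sum.cong refl arg_cong[of _ _ prod_list] map_cong assms)
     (auto dest: set_blocks_length_le set_block_subset)

lemma conv_power_add:
  "conv_power F (j + k) xs =
     (\<Sum>p\<le>length xs. conv_power F j (take p xs) * conv_power F k (drop p xs))"
proof -
  let ?g = "\<lambda>us vs. (\<Prod>b\<leftarrow>blocks us (take (sum_list us) xs). F b) *
                   (\<Prod>b\<leftarrow>blocks vs (drop (sum_list us) xs). F b)"
  have "conv_power F (j + k) xs = (\<Sum>is\<in>compositions (j + k) (length xs). ?g (take j is) (drop j is))"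
    unfolding conv_power_def
    by (intro sum.cong refl, subst append_take_drop_id[symmetric, of _ j], subst blocks_append) simp
  also have "\<dots> = (\<Sum>p\<le>length xs. \<Sum>us\<in>compositions j p. \<Sum>vs\<in>compositions k (length xs - p). ?g us vs)"
    by (rule sum_compositions_add)
  also have "\<dots> = (\<Sum>p\<le>length xs. conv_power F j (take p xs) * conv_power F k (drop p xs))"
    by (intro sum.cong refl, simp add: conv_power_def sum_product min_absorb2)
       (intro sum.cong refl, simp add: compositions_def)
  finally show ?thesis .
qed

text \<open>
  Double series supported in a rectangle are summed below along antidiagonals or along rows;
  the corner \<open>(a, b)\<close> lies on the last antidiagonal.
\<close>

lemma sum_triangle_rectangle:
  fixes f :: "nat \<Rightarrow> nat \<Rightarrow> 'c::comm_monoid_add"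
  assumes "\<And>i j. a < i \<Longrightarrow> f i j = 0" "\<And>i j. b < j \<Longrightarrow> f i j = 0"
  shows "(\<Sum>k\<le>a + b. \<Sum>i\<le>k. f i (k - i)) = (\<Sum>i\<le>a. \<Sum>j\<le>b. f i j)"
proof -
  have fin: "finite {(i, j). i + j \<le> a + b}"
    by (rule finite_subset[of _ "{..a + b} \<times> {..a + b}"]) auto
  have "(\<Sum>k\<le>a + b. \<Sum>i\<le>k. f i (k - i)) = (\<Sum>(i, j)\<in>{(i, j). i + j \<le> a + b}. f i j)"
    by (rule sum.triangle_reindex_eq[symmetric])
  also have "\<dots> = (\<Sum>(i, j)\<in>{..a} \<times> {..b}. f i j)"
    by (intro sum.mono_neutral_right fin) (auto, metis assms(1) not_le, metis assms(2) not_le)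
  finally show ?thesis by (simp add: sum.cartesian_product)
qed

text \<open>
  Substitution of \<open>F\<close> into a power series in the convolution algebra. The sum stops at the
  length of the word, because the higher powers vanish on it.
\<close>

definition conv_series :: "'k::comm_ring_1 fps \<Rightarrow> ('a list \<Rightarrow> 'k) \<Rightarrow> 'a list \<Rightarrow> 'k" where
  "conv_series f F xs = (\<Sum>i\<le>length xs. fps_nth f i * conv_power F i xs)"

text \<open>
  Substitution is a homomorphism from power series to the convolution algebra; hence powers of a
  series without constant term are obtained by substituting into the powers of that series.
\<close>

lemma conv_series_mult:
  "conv_series (f * g) F xs =
     (\<Sum>p\<le>length xs. conv_series f F (take p xs) * conv_series g F (drop p xs))"
proof -
  let ?n = "length xs"
  have "(\<Sum>p\<le>?n. conv_series f F (take p xs) * conv_series g F (drop p xs))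
      = (\<Sum>p\<le>?n. \<Sum>r\<le>?n. \<Sum>i\<le>r. fps_nth f i * fps_nth g (r - i) *
           (conv_power F i (take p xs) * conv_power F (r - i) (drop p xs)))"
  proof (rule sum.cong[OF refl])
    fix p assume "p \<in> {..?n}"
    then have p: "p + (?n - p) = ?n" "length (take p xs) = p" by auto
    have "conv_series f F (take p xs) * conv_series g F (drop p xs) =
       (\<Sum>i\<le>p. \<Sum>j\<le>?n - p. fps_nth f i * fps_nth g j * (conv_power F i (take p xs) * conv_power F j (drop p xs)))"
      unfolding conv_series_def p length_drop by (simp add: sum_product mult_ac)
    also have "\<dots> = (\<Sum>r\<le>p + (?n - p). \<Sum>i\<le>r. fps_nth f i * fps_nth g (r - i) *
           (conv_power F i (take p xs) * conv_power F (r - i) (drop p xs)))"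
      by (rule sum_triangle_rectangle[symmetric]) (simp_all add: conv_power_eq_0 p)
    finally show "conv_series f F (take p xs) * conv_series g F (drop p xs) =
       (\<Sum>r\<le>?n. \<Sum>i\<le>r. fps_nth f i * fps_nth g (r - i) *
           (conv_power F i (take p xs) * conv_power F (r - i) (drop p xs)))"
      unfolding p .
  qed
  also have "\<dots> = (\<Sum>r\<le>?n. \<Sum>p\<le>?n. \<Sum>i\<le>r. fps_nth f i * fps_nth g (r - i) *
           (conv_power F i (take p xs) * conv_power F (r - i) (drop p xs)))"
    by (rule sum.swap)
  also have "\<dots> = (\<Sum>r\<le>?n. \<Sum>i\<le>r. fps_nth f i * fps_nth g (r - i) *
           (\<Sum>p\<le>?n. conv_power F i (take p xs) * conv_power F (r - i) (drop p xs)))"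
    unfolding sum_distrib_left by (rule sum.cong[OF refl], rule sum.swap)
  also have "\<dots> = (\<Sum>r\<le>?n. \<Sum>i\<le>r. fps_nth f i * fps_nth g (r - i) * conv_power F r xs)"
    by (intro sum.cong refl) (simp add: conv_power_add[symmetric])
  also have "\<dots> = conv_series (f * g) F xs"
    by (simp add: conv_series_def fps_mult_nth sum_distrib_right atMost_atLeast0)
  finally show ?thesis by simp
qed

lemma conv_power_conv_series:
  assumes "fps_nth f 0 = 0"
  shows "conv_power (conv_series f F) m xs = conv_series (f ^ m) F xs"
proof (induction m arbitrary: xs)
  case 0
  show ?case by (auto simp: conv_power_0 conv_series_def intro!: sum.neutral)
next
  case (Suc m)
  have one: "conv_power (conv_series f F) (Suc 0) ys = conv_series f F ys" for ys
    using assms by (simp add: conv_power_1 conv_series_def)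
  have "conv_power (conv_series f F) (Suc m) xs =
     (\<Sum>p\<le>length xs. conv_power (conv_series f F) (Suc 0) (take p xs) * conv_power (conv_series f F) m (drop p xs))"
    using conv_power_add[of "conv_series f F" "Suc 0" m xs] by simp
  also have "\<dots> = conv_series (f ^ Suc m) F xs"
    by (simp only: one Suc.IH conv_series_mult power_Suc)
  finally show ?case .
qed

lemma conv_power_Suc:
  "conv_power F (Suc k) xs =
     (\<Sum>q<length xs. F (take (Suc q) xs) * conv_power F k (drop (Suc q) xs))"
proof -
  have "conv_power F (Suc k) xs =
      (\<Sum>q\<le>length xs. conv_power F (Suc 0) (take q xs) * conv_power F k (drop q xs))"
    using conv_power_add[of F "Suc 0" k xs] by simp
  also have "\<dots> = (\<Sum>q<length xs. F (take (Suc q) xs) * conv_power F k (drop (Suc q) xs))"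
    by (cases xs) (simp_all add: conv_power_1 sum.atMost_Suc_shift lessThan_Suc_atMost del: sum.atMost_Suc)
  finally show ?thesis .
qed

lemma conv_series_map: "conv_series f P (map g xs) = conv_series f (\<lambda>b. P (map g b)) xs"
  by (simp add: conv_series_def conv_power_def blocks_map comp_def)

lemma conv_series_cong:
  assumes "\<And>b. length b \<le> length xs \<Longrightarrow> set b \<subseteq> set xs \<Longrightarrow> F b = G b"
  shows "conv_series f F xs = conv_series f G xs"
  unfolding conv_series_def using conv_power_cong[of xs F G] assms by simp

lemma conv_series_singleton: "fps_nth f 0 = 0 \<Longrightarrow> conv_series f P [a] = fps_nth f 1 * P [a]"
  by (simp add: conv_series_def conv_power_1)

text \<open>
  The sum over compositions with a distinguished letter after the \<open>j\<close>-th block, as it occurs in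
  the recursion, is the convolution product \<open>F\<^sup>j A F\<^sup>k\<^sup>-\<^sup>j\<close> with \<open>A\<close> supported on single letters.
\<close>

lemma sum_compositions_around_letter:
  fixes F :: "'a list \<Rightarrow> 'k::comm_ring_1"
  assumes "j \<le> k" "xs \<noteq> []"
  shows "(\<Sum>is\<in>compositions k (length xs - 1).
            let p = sum_list (take j is) in
              (\<Prod>b\<leftarrow>blocks (take j is) (take p xs). F b) * a p *
              (\<Prod>b\<leftarrow>blocks (drop j is) (drop (Suc p) xs). F b)) =
         (\<Sum>p<length xs. a p * (conv_power F j (take p xs) * conv_power F (k - j) (drop (Suc p) xs)))"
proof -
  let ?g = "\<lambda>us vs. let p = sum_list us in (\<Prod>b\<leftarrow>blocks us (take p xs). F b) * a p *
              (\<Prod>b\<leftarrow>blocks vs (drop (Suc p) xs). F b)"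
  have "(\<Sum>is\<in>compositions (j + (k - j)) (length xs - 1). ?g (take j is) (drop j is)) =
     (\<Sum>p\<le>length xs - 1. \<Sum>us\<in>compositions j p. \<Sum>vs\<in>compositions (k - j) (length xs - 1 - p). ?g us vs)"
    by (rule sum_compositions_add)
  also have "\<dots> = (\<Sum>p\<le>length xs - 1. a p * (conv_power F j (take p xs) * conv_power F (k - j) (drop (Suc p) xs)))"
  proof (rule sum.cong[OF refl])
    fix p assume "p \<in> {..length xs - 1}"
    then have p: "min (length xs) p = p" "length xs - 1 - p = length xs - Suc p" by auto
    show "(\<Sum>us\<in>compositions j p. \<Sum>vs\<in>compositions (k - j) (length xs - 1 - p). ?g us vs) =
        a p * (conv_power F j (take p xs) * conv_power F (k - j) (drop (Suc p) xs))"
      unfolding conv_power_def sum_product unfolding sum_distrib_left length_take length_drop p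
      by (rule sum.cong[OF refl], rule sum.cong[OF refl]) (simp add: compositions_def Let_def mult_ac)
  qed
  also have "{..length xs - 1} = {..<length xs}"
    using assms(2) by (cases xs) auto
  finally show ?thesis using assms(1) by simp
qed

section \<open>The differential equation of the logarithm\<close>

text \<open>
  On the left, \<open>u\<^sub>i\<close> and \<open>v\<^sub>j\<close> stand for the values of \<open>P\<^sup>i\<close> and \<open>P\<^sup>j\<close> on the words before and
  after a letter, and the sum is the derivative of \<open>log (1 + P)\<close>, with \<open>P' = (1 + P) A\<close>; the factor
  \<open>1 + P\<close> gives \<open>u\<^sub>i + u\<^sub>i\<^sub>+\<^sub>1\<close>. Collecting the coefficient of \<open>u\<^sub>i v\<^sub>j\<close> leads to
  \<open>bernoulli_kernel_ln_coeff\<close>.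
\<close>

lemma ln_kernel_sum:
  fixes u v :: "nat \<Rightarrow> 'k::field_char_0"
  assumes u: "\<And>i. a < i \<Longrightarrow> u i = 0" and v: "\<And>j. b < j \<Longrightarrow> v j = 0"
  shows "(\<Sum>k\<le>Suc (a + b). fps_nth (fps_ln 1) k * (\<Sum>i<k. (u i + u (Suc i)) * v (k - Suc i))) =
    (\<Sum>i\<le>a. \<Sum>j\<le>b. (\<Sum>m\<le>i. \<Sum>q\<le>j. bernoulli_kernel m q *
        fps_nth (fps_ln 1 ^ m) i * fps_nth (fps_ln 1 ^ q) j) * (u i * v j))"
proof -
  let ?L = "fps_nth (fps_ln (1::'k))"
  \<comment> \<open>Moving the index of the second summand of \<open>u\<^sub>i + u\<^sub>i\<^sub>+\<^sub>1\<close>; nothing is lost at the upper end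
      because \<open>u\<close> vanishes there.\<close>
  have shift: "(\<Sum>i\<le>a. ?L (Suc (i + j)) * u (Suc i)) = (\<Sum>i\<le>a. (if i = 0 then 0 else ?L (i + j)) * u i)" for j
  proof -
    have "(\<Sum>i\<le>a. (if i = 0 then 0 else ?L (i + j)) * u i) = (\<Sum>i\<le>Suc a. (if i = 0 then 0 else ?L (i + j)) * u i)"
      by (simp add: u)
    also have "\<dots> = (\<Sum>i\<le>a. ?L (Suc (i + j)) * u (Suc i))"
      by (subst sum.atMost_Suc_shift) simp
    finally show ?thesis by simp
  qed
  have "(\<Sum>k\<le>Suc (a + b). ?L k * (\<Sum>i<k. (u i + u (Suc i)) * v (k - Suc i)))
      = (\<Sum>k\<le>a + b. \<Sum>i\<le>k. ?L (Suc (i + (k - i))) * (u i + u (Suc i)) * v (k - i))"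
    by (subst sum.atMost_Suc_shift) (simp add: fps_ln_nth sum_distrib_left lessThan_Suc_atMost mult_ac)
  also have "\<dots> = (\<Sum>i\<le>a. \<Sum>j\<le>b. ?L (Suc (i + j)) * (u i + u (Suc i)) * v j)"
    by (rule sum_triangle_rectangle) (simp_all add: u v)
  also have "\<dots> = (\<Sum>j\<le>b. (\<Sum>i\<le>a. ?L (Suc (i + j)) * u i) * v j + (\<Sum>i\<le>a. ?L (Suc (i + j)) * u (Suc i)) * v j)"
    by (subst sum.swap) (simp add: sum_distrib_right sum.distrib distrib_left distrib_right)
  also have "\<dots> = (\<Sum>i\<le>a. \<Sum>j\<le>b. (?L (Suc (i + j)) + (if i = 0 then 0 else ?L (i + j))) * (u i * v j))"
    unfolding shift by (rule trans[OF _ sum.swap]) (simp only: sum_distrib_right sum.distrib distrib_right mult.assoc)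
  also have "\<dots> = (\<Sum>i\<le>a. \<Sum>j\<le>b. (\<Sum>m\<le>i. \<Sum>q\<le>j. bernoulli_kernel m q *
        fps_nth (fps_ln 1 ^ m) i * fps_nth (fps_ln 1 ^ q) j) * (u i * v j))"
    unfolding bernoulli_kernel_ln_coeff
    by (intro sum.cong refl arg_cong2[where f = "(*)"]) (auto simp: fps_ln_nth power_minus_mult gr0_conv_Suc)
  finally show ?thesis .
qed

text \<open>
  The algebraic core of the Magnus equation: with \<open>M = log (1 + F)\<close>, the derivative of the
  logarithm and the Bernoulli series in \<open>- ad M\<close> agree as bilinear expressions in the words
  \<open>l\<close> and \<open>r\<close> to the left and to the right of the letter that is differentiated.
\<close>

lemma conv_series_ln_kernel:
  fixes F :: "'a list \<Rightarrow> 'k::field_char_0"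
  defines "M \<equiv> conv_series (fps_ln 1) F"
  shows "(\<Sum>k\<le>Suc (length l + length r). fps_nth (fps_ln 1) k *
           (\<Sum>i<k. (conv_power F i l + conv_power F (Suc i) l) * conv_power F (k - Suc i) r)) =
         (\<Sum>k\<le>length l + length r. bernoulli_num k / fact k *
           (\<Sum>m\<le>k. (-1) ^ m * of_nat (k choose m) * (conv_power M m l * conv_power M (k - m) r)))"
    (is "?lhs = ?rhs")
proof -
  let ?a = "length l" and ?b = "length r"
  let ?l = "\<lambda>m. fps_nth (fps_ln (1::'k) ^ m)"
  have ext: "conv_power M m ys = (\<Sum>i\<le>length ys. ?l m i * conv_power F i ys)" for m ys
    unfolding M_def by (subst conv_power_conv_series) (simp_all add: conv_series_def fps_ln_0)
  have "?rhs = (\<Sum>k\<le>?a + ?b. \<Sum>m\<le>k. bernoulli_kernel m (k - m) * (conv_power M m l * conv_power M (k - m) r))"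
    by (simp add: sum_distrib_left bernoulli_kernel_binomial mult.assoc)
  also have "\<dots> = (\<Sum>m\<le>?a. \<Sum>q\<le>?b. bernoulli_kernel m q * (conv_power M m l * conv_power M q r))"
    by (rule sum_triangle_rectangle) (simp_all add: conv_power_eq_0)
  also have "\<dots> = (\<Sum>m\<le>?a. \<Sum>q\<le>?b. \<Sum>i\<le>?a. \<Sum>j\<le>?b. bernoulli_kernel m q * ?l m i * ?l q j *
       (conv_power F i l * conv_power F j r))"
    unfolding ext sum_product by (simp add: sum_distrib_left mult_ac)
  also have "\<dots> = (\<Sum>m\<le>?a. \<Sum>i\<le>?a. \<Sum>q\<le>?b. \<Sum>j\<le>?b. bernoulli_kernel m q * ?l m i * ?l q j *
       (conv_power F i l * conv_power F j r))"
    by (rule sum.cong[OF refl], rule sum.swap)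
  also have "\<dots> = (\<Sum>i\<le>?a. \<Sum>m\<le>?a. \<Sum>q\<le>?b. \<Sum>j\<le>?b. bernoulli_kernel m q * ?l m i * ?l q j *
       (conv_power F i l * conv_power F j r))"
    by (rule sum.swap)
  also have "\<dots> = (\<Sum>i\<le>?a. \<Sum>m\<le>?a. \<Sum>j\<le>?b. \<Sum>q\<le>?b. bernoulli_kernel m q * ?l m i * ?l q j *
       (conv_power F i l * conv_power F j r))"
    by (rule sum.cong[OF refl], rule sum.cong[OF refl], rule sum.swap)
  also have "\<dots> = (\<Sum>i\<le>?a. \<Sum>j\<le>?b. \<Sum>m\<le>?a. \<Sum>q\<le>?b. bernoulli_kernel m q * ?l m i * ?l q j *
       (conv_power F i l * conv_power F j r))"
    by (rule sum.cong[OF refl], rule sum.swap)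
  also have "\<dots> = (\<Sum>i\<le>?a. \<Sum>j\<le>?b. (\<Sum>m\<le>i. \<Sum>q\<le>j. bernoulli_kernel m q * ?l m i * ?l q j) *
       (conv_power F i l * conv_power F j r))"
  proof (intro sum.cong refl)
    fix i j assume ij: "i \<in> {..?a}" "j \<in> {..?b}"
    have "(\<Sum>m\<le>?a. \<Sum>q\<le>?b. bernoulli_kernel m q * ?l m i * ?l q j) = (\<Sum>m\<le>i. \<Sum>q\<le>?b. bernoulli_kernel m q * ?l m i * ?l q j)"
      using ij by (intro sum.mono_neutral_right) (auto simp: fps_ln_power_nth_eq_0)
    also have "\<dots> = (\<Sum>m\<le>i. \<Sum>q\<le>j. bernoulli_kernel m q * ?l m i * ?l q j)"
      using ij by (intro sum.cong refl sum.mono_neutral_right) (auto simp: fps_ln_power_nth_eq_0)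
    finally show "(\<Sum>m\<le>?a. \<Sum>q\<le>?b. bernoulli_kernel m q * ?l m i * ?l q j * (conv_power F i l * conv_power F j r))
        = (\<Sum>m\<le>i. \<Sum>q\<le>j. bernoulli_kernel m q * ?l m i * ?l q j) * (conv_power F i l * conv_power F j r)"
      by (simp only: sum_distrib_right[symmetric])
  qed
  also have "\<dots> = ?lhs"
    by (rule ln_kernel_sum[symmetric]) (simp_all add: conv_power_eq_0)
  finally show ?thesis by simp
qed

lemma sum_triangle_shift:
  fixes h :: "nat \<Rightarrow> nat \<Rightarrow> 'c::comm_monoid_add"
  shows "(\<Sum>q<n. \<Sum>p<n - Suc q. h q (p + Suc q)) = (\<Sum>p<n. \<Sum>q<p. h q p)"
  unfolding sum.Sigma[OF finite_lessThan ballI[OF finite_lessThan]]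
  by (rule sum.reindex_bij_witness[where j = "\<lambda>(q, p). (p + Suc q, q)" and i = "\<lambda>(p, q). (q, p - Suc q)"]) auto

text \<open>
  The relation \<open>D f f'\<close> says that \<open>f'\<close> is a derivative of \<open>f\<close> on the domain \<open>S\<close>. A relation
  instead of an operator lets one argument cover polynomial functions over an arbitrary field
  and real functions that are differentiable only on \<open>[0,1]\<close>.
\<close>

locale differentiation =
  fixes S :: "'k::field_char_0 set"
    and D :: "('k \<Rightarrow> 'k) \<Rightarrow> ('k \<Rightarrow> 'k) \<Rightarrow> bool"
  assumes const: "D (\<lambda>_. c) (\<lambda>_. 0)"
    and add: "D f f' \<Longrightarrow> D g g' \<Longrightarrow> D (\<lambda>t. f t + g t) (\<lambda>t. f' t + g' t)"
    and mult: "D f f' \<Longrightarrow> D g g' \<Longrightarrow> D (\<lambda>t. f t * g t) (\<lambda>t. f' t * g t + f t * g' t)"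
    and unique: "D f h \<Longrightarrow> D g h \<Longrightarrow> f 0 = g 0 \<Longrightarrow> s \<in> S \<Longrightarrow> f s = g s"
begin

lemma cmult: "D f f' \<Longrightarrow> D (\<lambda>t. c * f t) (\<lambda>t. c * f' t)"
  using mult[OF const[of c], of f f'] by simp

lemma sum: "(\<And>i. i \<in> X \<Longrightarrow> D (f i) (f' i)) \<Longrightarrow> D (\<lambda>t. \<Sum>i\<in>X. f i t) (\<lambda>t. \<Sum>i\<in>X. f' i t)"
  by (induction X rule: infinite_finite_induct) (simp_all add: const add)

text \<open>
  The Leibniz rule for \<open>P\<^sup>k\<close>, where \<open>I = 1 + P\<close> and \<open>I' = I A\<close>: the \<open>i\<close>-th factor is replaced by
  \<open>(1 + P) A\<close>.
\<close>

lemma deriv_conv_power: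
  assumes nil: "\<And>t. I t [] = 1"
    and deriv: "\<And>b a. set (b @ [a]) \<subseteq> set xs \<Longrightarrow> D (\<lambda>t. I t (b @ [a])) (\<lambda>t. I t b * A a t)"
  shows "D (\<lambda>t. conv_power (I t) k xs)
     (\<lambda>t. \<Sum>p<length xs. A (xs ! p) t *
        (\<Sum>i<k. (conv_power (I t) i (take p xs) + conv_power (I t) (Suc i) (take p xs)) *
               conv_power (I t) (k - Suc i) (drop (Suc p) xs)))"
  using deriv
proof (induction k arbitrary: xs)
  case 0
  show ?case by (simp add: conv_power_0 const)
next
  case (Suc k)
  let ?n = "length xs"
  let ?G = "\<lambda>t i p. conv_power (I t) i (take p xs) + conv_power (I t) (Suc i) (take p xs)"
  \<comment> \<open>The contribution in which the first block has length \<open>q + 1\<close> and the letter at position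
      \<open>p > q\<close>, counted in the whole word, is differentiated.\<close>
  define h where "h t q p = I t (take (Suc q) xs) * (A (xs ! p) t *
       (\<Sum>i<k. (conv_power (I t) i (take (p - Suc q) (drop (Suc q) xs)) +
             conv_power (I t) (Suc i) (take (p - Suc q) (drop (Suc q) xs))) *
          conv_power (I t) (k - Suc i) (drop (Suc p) xs)))" for t q p
  have head: "D (\<lambda>t. I t (take (Suc q) xs)) (\<lambda>t. I t (take q xs) * A (xs ! q) t)" if "q < ?n" for q
    using Suc.prems[of "take q xs" "xs ! q"] that set_take_subset[of "Suc q" xs]
    by (simp add: take_Suc_conv_app_nth)
  have tail: "D (\<lambda>t. conv_power (I t) k (drop (Suc q) xs))
      (\<lambda>t. \<Sum>p<?n - Suc q. A (xs ! (p + Suc q)) t *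
        (\<Sum>i<k. (conv_power (I t) i (take p (drop (Suc q) xs)) + conv_power (I t) (Suc i) (take p (drop (Suc q) xs))) *
               conv_power (I t) (k - Suc i) (drop (Suc (p + Suc q)) xs)))" if "q < ?n" for q
  proof -
    have "\<And>b a. set (b @ [a]) \<subseteq> set (drop (Suc q) xs) \<Longrightarrow> D (\<lambda>t. I t (b @ [a])) (\<lambda>t. I t b * A a t)"
      using Suc.prems set_drop_subset[of "Suc q" xs] by blast
    from Suc.IH[of "drop (Suc q) xs", OF this] that show ?thesis by (simp add: add.commute[of _ q])
  qed
  have "D (\<lambda>t. \<Sum>q<?n. I t (take (Suc q) xs) * conv_power (I t) k (drop (Suc q) xs))
     (\<lambda>t. \<Sum>q<?n. I t (take q xs) * A (xs ! q) t * conv_power (I t) k (drop (Suc q) xs) +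
        (\<Sum>p<?n - Suc q. h t q (p + Suc q)))"
    unfolding h_def add_diff_cancel_right' sum_distrib_left[symmetric]
    by (intro sum mult head tail) auto
  moreover have "(\<Sum>q<?n. I t (take q xs) * A (xs ! q) t * conv_power (I t) k (drop (Suc q) xs) +
        (\<Sum>p<?n - Suc q. h t q (p + Suc q))) =
      (\<Sum>p<?n. A (xs ! p) t * (\<Sum>i<Suc k. ?G t i p * conv_power (I t) (Suc k - Suc i) (drop (Suc p) xs)))" for t
  proof -
    have "(\<Sum>q<p. h t q p) = A (xs ! p) t * (\<Sum>i<k. ?G t (Suc i) p * conv_power (I t) (k - Suc i) (drop (Suc p) xs))"
      if "p < ?n" for p
    proof -
      have G: "?G t (Suc i) p = (\<Sum>q<p. I t (take (Suc q) xs) *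
          (conv_power (I t) i (take (p - Suc q) (drop (Suc q) xs)) +
           conv_power (I t) (Suc i) (take (p - Suc q) (drop (Suc q) xs))))" for i
        unfolding conv_power_Suc[of "I t" i "take p xs"] conv_power_Suc[of "I t" "Suc i" "take p xs"] sum.distrib[symmetric]
        using that by (intro sum.cong) (auto simp: min_absorb2 min_absorb1 drop_take distrib_left)
      show ?thesis unfolding G h_def
        by (simp only: sum_distrib_left sum_distrib_right, rule trans[OF sum.swap]) (simp only: mult_ac)
    qed
    then have second: "(\<Sum>q<?n. \<Sum>p<?n - Suc q. h t q (p + Suc q)) =
        (\<Sum>p<?n. A (xs ! p) t * (\<Sum>i<k. ?G t (Suc i) p * conv_power (I t) (k - Suc i) (drop (Suc p) xs)))"
      unfolding sum_triangle_shift by simp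
    have "?G t 0 p = I t (take p xs)" if "p < ?n" for p
      using that by (auto simp: conv_power_0 conv_power_1 nil)
    then have first: "(\<Sum>q<?n. I t (take q xs) * A (xs ! q) t * conv_power (I t) k (drop (Suc q) xs)) =
        (\<Sum>p<?n. A (xs ! p) t * (?G t 0 p * conv_power (I t) k (drop (Suc p) xs)))"
      by (intro sum.cong refl) (simp add: mult_ac)
    have split: "(\<Sum>i<Suc k. ?G t i p * conv_power (I t) (Suc k - Suc i) (drop (Suc p) xs)) =
        ?G t 0 p * conv_power (I t) k (drop (Suc p) xs) +
        (\<Sum>i<k. ?G t (Suc i) p * conv_power (I t) (k - Suc i) (drop (Suc p) xs))" for p
      by (simp only: sum.lessThan_Suc_shift diff_Suc_Suc diff_zero)
    show ?thesis
      unfolding sum.distrib first second split by (simp only: distrib_left sum.distrib)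
  qed
  ultimately show ?case unfolding conv_power_Suc[of _ k] by simp
qed

text \<open>
  The Magnus equation \<open>M' = (\<Sum>k. B\<^sub>k / k! (- ad M)\<^sup>k) A\<close> evaluated on a word, where only
  \<open>k < n\<close> contributes because each factor \<open>M\<close> uses up at least one of the \<open>n - 1\<close> letters left by
  \<open>A\<close>.
\<close>

lemma deriv_log:
  fixes I :: "'k \<Rightarrow> 'a list \<Rightarrow> 'k"
  defines "M \<equiv> \<lambda>t. conv_series (fps_ln 1) (I t)"
  assumes nil: "\<And>t. I t [] = 1"
    and deriv: "\<And>b a. set (b @ [a]) \<subseteq> set xs \<Longrightarrow> D (\<lambda>t. I t (b @ [a])) (\<lambda>t. I t b * A a t)"
  shows "D (\<lambda>t. M t xs)
     (\<lambda>t. \<Sum>p<length xs. A (xs ! p) t *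
        (\<Sum>k<length xs. bernoulli_num k / fact k *
           (\<Sum>m\<le>k. (-1) ^ m * of_nat (k choose m) *
              (conv_power (M t) m (take p xs) * conv_power (M t) (k - m) (drop (Suc p) xs)))))"
proof -
  let ?n = "length xs"
  let ?T = "\<lambda>t k p. \<Sum>i<k. (conv_power (I t) i (take p xs) + conv_power (I t) (Suc i) (take p xs)) *
               conv_power (I t) (k - Suc i) (drop (Suc p) xs)"
  have "D (\<lambda>t. \<Sum>k\<le>?n. fps_nth (fps_ln 1) k * conv_power (I t) k xs)
     (\<lambda>t. \<Sum>k\<le>?n. fps_nth (fps_ln 1) k * (\<Sum>p<?n. A (xs ! p) t * ?T t k p))"
    by (intro sum cmult deriv_conv_power nil deriv)
  moreover have "(\<Sum>k\<le>?n. fps_nth (fps_ln 1) k * (\<Sum>p<?n. A (xs ! p) t * ?T t k p)) =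
     (\<Sum>p<?n. A (xs ! p) t * (\<Sum>k<?n. bernoulli_num k / fact k *
           (\<Sum>m\<le>k. (-1) ^ m * of_nat (k choose m) *
              (conv_power (M t) m (take p xs) * conv_power (M t) (k - m) (drop (Suc p) xs)))))" for t
  proof -
    have core: "(\<Sum>k\<le>?n. fps_nth (fps_ln 1) k * ?T t k p) = (\<Sum>k<?n. bernoulli_num k / fact k *
           (\<Sum>m\<le>k. (-1) ^ m * of_nat (k choose m) *
              (conv_power (M t) m (take p xs) * conv_power (M t) (k - m) (drop (Suc p) xs))))" if "p < ?n" for p
    proof -
      have n: "Suc (length (take p xs) + length (drop (Suc p) xs)) = ?n" using that by simp
      show ?thesis
        using conv_series_ln_kernel[where l = "take p xs" and r = "drop (Suc p) xs" and F = "I t"]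
        unfolding n M_def lessThan_Suc_atMost[symmetric] n by simp
    qed
    have "(\<Sum>k\<le>?n. fps_nth (fps_ln 1) k * (\<Sum>p<?n. A (xs ! p) t * ?T t k p)) =
        (\<Sum>k\<le>?n. \<Sum>p<?n. A (xs ! p) t * (fps_nth (fps_ln 1) k * ?T t k p))"
      by (simp only: sum_distrib_left mult.left_commute)
    also have "\<dots> = (\<Sum>p<?n. A (xs ! p) t * (\<Sum>k\<le>?n. fps_nth (fps_ln 1) k * ?T t k p))"
      unfolding sum_distrib_left[of "A _ _"] by (rule sum.swap)
    also have "\<dots> = (\<Sum>p<?n. A (xs ! p) t * (\<Sum>k<?n. bernoulli_num k / fact k *
           (\<Sum>m\<le>k. (-1) ^ m * of_nat (k choose m) *
              (conv_power (M t) m (take p xs) * conv_power (M t) (k - m) (drop (Suc p) xs)))))"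
      by (rule sum.cong[OF refl], rule arg_cong2[where f = "(*)", OF refl], rule core) simp
    finally show ?thesis .
  qed
  ultimately show ?thesis unfolding M_def conv_series_def by simp
qed

text \<open>
  Both sides vanish at \<open>0\<close> and have the same derivative. The term \<open>k = 0\<close> of the Magnus
  equation is \<open>A\<close> itself; it vanishes on words with at least two letters, so the recursion
  starts at \<open>k = 1\<close>.
\<close>

lemma magnus_recursion:
  fixes I :: "'k \<Rightarrow> 'a list \<Rightarrow> 'k"
  defines "M \<equiv> \<lambda>t. conv_series (fps_ln 1) (I t)"
  assumes nil: "\<And>t. I t [] = 1"
    and deriv: "\<And>b a. set (b @ [a]) \<subseteq> set xs \<Longrightarrow> D (\<lambda>t. I t (b @ [a])) (\<lambda>t. I t b * A a t)"
    and init: "\<And>b. b \<noteq> [] \<Longrightarrow> I 0 b = 0"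
    and len: "2 \<le> length xs" and s: "s \<in> S"
    and N_deriv: "\<And>k j is. j \<le> k \<Longrightarrow> is \<in> compositions k (length xs - 1) \<Longrightarrow>
       D (N j is) (\<lambda>t. let p = sum_list (take j is) in
              (\<Prod>b\<leftarrow>blocks (take j is) (take p xs). M t b) * A (xs ! p) t *
              (\<Prod>b\<leftarrow>blocks (drop j is) (drop (Suc p) xs). M t b))"
    and N_init: "\<And>j is. N j is 0 = 0"
  shows "M s xs = (\<Sum>k = 1..length xs - 1. bernoulli_num k / fact k *
            (\<Sum>j = 0..k. (-1) ^ j * of_nat (k choose j) *
               (\<Sum>is\<in>compositions k (length xs - 1). N j is s)))"
proof -
  let ?n = "length xs"
  let ?c = "\<lambda>t k j p. conv_power (M t) j (take p xs) * conv_power (M t) (k - j) (drop (Suc p) xs)"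
  define R where "R t = (\<Sum>k = 1..?n - 1. bernoulli_num k / fact k *
            (\<Sum>j = 0..k. (-1) ^ j * of_nat (k choose j) *
               (\<Sum>is\<in>compositions k (?n - 1). N j is t)))" for t
  have ne: "xs \<noteq> []" using len by auto
  have "D R (\<lambda>t. \<Sum>k = 1..?n - 1. bernoulli_num k / fact k *
            (\<Sum>j = 0..k. (-1) ^ j * of_nat (k choose j) *
               (\<Sum>is\<in>compositions k (?n - 1). let p = sum_list (take j is) in
              (\<Prod>b\<leftarrow>blocks (take j is) (take p xs). M t b) * A (xs ! p) t *
              (\<Prod>b\<leftarrow>blocks (drop j is) (drop (Suc p) xs). M t b))))"
    unfolding R_def[abs_def] by (intro sum cmult N_deriv) auto
  moreover have "(\<Sum>k = 1..?n - 1. bernoulli_num k / fact k *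
            (\<Sum>j = 0..k. (-1) ^ j * of_nat (k choose j) *
               (\<Sum>is\<in>compositions k (?n - 1). let p = sum_list (take j is) in
              (\<Prod>b\<leftarrow>blocks (take j is) (take p xs). M t b) * A (xs ! p) t *
              (\<Prod>b\<leftarrow>blocks (drop j is) (drop (Suc p) xs). M t b)))) =
     (\<Sum>p<?n. A (xs ! p) t * (\<Sum>k<?n. bernoulli_num k / fact k *
           (\<Sum>m\<le>k. (-1) ^ m * of_nat (k choose m) * ?c t k m p)))" for t
  proof -
    have "(\<Sum>k = 1..?n - 1. bernoulli_num k / fact k *
            (\<Sum>j = 0..k. (-1) ^ j * of_nat (k choose j) *
               (\<Sum>is\<in>compositions k (?n - 1). let p = sum_list (take j is) in
              (\<Prod>b\<leftarrow>blocks (take j is) (take p xs). M t b) * A (xs ! p) t *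
              (\<Prod>b\<leftarrow>blocks (drop j is) (drop (Suc p) xs). M t b))))
       = (\<Sum>k = 1..?n - 1. bernoulli_num k / fact k *
            (\<Sum>j = 0..k. (-1) ^ j * of_nat (k choose j) * (\<Sum>p<?n. A (xs ! p) t * ?c t k j p)))"
      by (intro sum.cong refl arg_cong2[where f = "(*)"]
          sum_compositions_around_letter[where a = "\<lambda>p. A (xs ! p) t"] ne) auto
    also have "\<dots> = (\<Sum>k<?n. bernoulli_num k / fact k *
            (\<Sum>j = 0..k. (-1) ^ j * of_nat (k choose j) * (\<Sum>p<?n. A (xs ! p) t * ?c t k j p)))"
    proof (rule sum.mono_neutral_left)
      show "\<forall>k\<in>{..<?n} - {1..?n - 1}. bernoulli_num k / fact k *
            (\<Sum>j = 0..k. (-1) ^ j * of_nat (k choose j) * (\<Sum>p<?n. A (xs ! p) t * ?c t k j p)) = 0"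
        using len by (auto simp: not_le conv_power_0 intro!: sum.neutral)
    qed auto
    also have "\<dots> = (\<Sum>k<?n. \<Sum>j\<le>k. \<Sum>p<?n. A (xs ! p) t * (bernoulli_num k / fact k * ((-1) ^ j * of_nat (k choose j) * ?c t k j p)))"
      unfolding atMost_atLeast0 sum_distrib_left by (simp only: mult_ac)
    also have "\<dots> = (\<Sum>k<?n. \<Sum>p<?n. \<Sum>j\<le>k. A (xs ! p) t * (bernoulli_num k / fact k * ((-1) ^ j * of_nat (k choose j) * ?c t k j p)))"
      by (rule sum.cong[OF refl], rule sum.swap)
    also have "\<dots> = (\<Sum>p<?n. \<Sum>k<?n. \<Sum>j\<le>k. A (xs ! p) t * (bernoulli_num k / fact k * ((-1) ^ j * of_nat (k choose j) * ?c t k j p)))"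
      by (rule sum.swap)
    finally show ?thesis by (simp only: sum_distrib_left)
  qed
  ultimately have DR: "D R (\<lambda>t. \<Sum>p<?n. A (xs ! p) t * (\<Sum>k<?n. bernoulli_num k / fact k *
           (\<Sum>m\<le>k. (-1) ^ m * of_nat (k choose m) * ?c t k m p)))"
    by simp
  have DM: "D (\<lambda>t. M t xs) (\<lambda>t. \<Sum>p<?n. A (xs ! p) t * (\<Sum>k<?n. bernoulli_num k / fact k *
           (\<Sum>m\<le>k. (-1) ^ m * of_nat (k choose m) * ?c t k m p)))"
    unfolding M_def using nil deriv by (rule deriv_log)
  have "conv_power (I 0) k xs = 0" for k
    using ne by (cases k) (auto simp: conv_power_0 conv_power_Suc init intro!: sum.neutral)
  then have "M 0 xs = R 0"
    by (simp add: M_def conv_series_def R_def N_init)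
  from unique[OF DM DR this s] show ?thesis by (simp add: R_def)
qed

end

section \<open>Composition with the logarithm and with a strict morphism\<close>

lemma concat_blocks: "sum_list is = length xs \<Longrightarrow> concat (blocks is xs) = xs"
  by (induction "is" arbitrary: xs) auto

lemma length_blocks: "length (blocks is xs) = length is"
  by (induction "is" arbitrary: xs) auto

lemma map_length_blocks: "sum_list is = length xs \<Longrightarrow> map length (blocks is xs) = is"
  by (induction "is" arbitrary: xs) auto

text \<open>
  The letter \<open>z\<close> lies in some block of every decomposition of the word.
\<close>

lemma conv_series_zero_letter:
  fixes P :: "'a list \<Rightarrow> 'k::idom"
  assumes "z \<in> set xs" and P: "\<And>b. z \<in> set b \<Longrightarrow> P b = 0"
  shows "conv_series f P xs = 0"
proof -
  have "(\<Prod>b\<leftarrow>blocks is xs. P b) = 0" if "sum_list is = length xs" for "is"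
  proof -
    have "z \<in> set (concat (blocks is xs))" using assms that by (simp add: concat_blocks)
    then show ?thesis using P by (force simp: prod_list_zero_iff)
  qed
  then show ?thesis
    by (simp add: conv_series_def conv_power_def compositions_def)
qed

lemma sum_whitney_dt: "(\<Sum>i\<in>X. whitney_dt (f i)) = whitney_dt (\<Sum>i\<in>X. f i)"
  by (induction X rule: infinite_finite_induct) (simp_all add: whitney_dt_def zero_prod_def)

lemma log_coeff_whitney_dt:
  "log_coeff (map whitney_dt cs) =
     whitney_dt (fps_nth (fps_ln 1) (length cs) * (prod_list cs :: 'k::field_char_0))"
proof (cases cs)
  case (Cons c cs')
  then show ?thesis
    by (cases cs') (auto simp: whitney_dt_def fps_ln_nth zero_prod_def comp_def)
qed (simp add: whitney_dt_def zero_prod_def)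

text \<open>
  On families of Taylor coefficients with values in multiples of \<open>dt\<close>, composition with \<open>log\<close> is
  the logarithm of the convolution algebra.
\<close>

lemma taylor_comp_log_coeff:
  fixes P :: "'a list \<Rightarrow> 'k::field_char_0"
  assumes "\<And>b. b \<noteq> [] \<Longrightarrow> set b \<subseteq> set xs \<Longrightarrow> F b = whitney_dt (P b)"
  shows "taylor_comp log_coeff F xs = whitney_dt (conv_series (fps_ln 1) P xs)"
proof -
  have "log_coeff (map F (blocks is xs)) =
      whitney_dt (fps_nth (fps_ln 1) k * (\<Prod>b\<leftarrow>blocks is xs. P b))"
    if "is \<in> compositions k (length xs)" for k "is"
  proof -
    have "map length (blocks is xs) = is" "length is = k" "0 \<notin> set is"
      using that by (auto simp: compositions_def map_length_blocks)
    then have "[] \<notin> set (blocks is xs)" by (metis image_eqI list.set_map list.size(3))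
    then have "map F (blocks is xs) = map whitney_dt (map P (blocks is xs))"
      using assms set_block_subset[of _ "is" xs] by (simp, metis)
    then show ?thesis
      using \<open>length is = k\<close> by (simp only: log_coeff_whitney_dt length_map length_blocks)
  qed
  then have "taylor_comp log_coeff F xs = (\<Sum>k = 1..length xs. \<Sum>is\<in>compositions k (length xs).
      whitney_dt (fps_nth (fps_ln 1) k * (\<Prod>b\<leftarrow>blocks is xs. P b)))"
    unfolding taylor_comp_def by (intro sum.cong refl) simp
  also have "\<dots> = whitney_dt (\<Sum>k = 1..length xs. fps_nth (fps_ln 1) k * conv_power P k xs)"
    by (simp only: sum_whitney_dt conv_power_def sum_distrib_left)
  also have "(\<Sum>k = 1..length xs. fps_nth (fps_ln 1) k * conv_power P k xs) = conv_series (fps_ln 1) P xs"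
    unfolding conv_series_def by (rule sum.mono_neutral_left) (auto simp: not_le fps_ln_nth)
  finally show ?thesis .
qed

text \<open>
  If the higher coefficients of \<open>F\<close> take the value \<open>z\<close>, which stands for zero, then every
  composition with a part of size at least two contributes nothing, and only the composition into
  ones is left. For the pullback of forms \<open>z\<close> is the zero form, and the words that occur consist of
  zero forms and of one-forms pulled back from admissible ones, so that all integrals exist.
\<close>

lemma taylor_comp_strict:
  assumes single: "\<And>x. x \<in> set xs \<Longrightarrow> F [x] = f x"
    and long: "\<And>b. 2 \<le> length b \<Longrightarrow> F b = z"
    and zero: "\<And>ys. z \<in> set ys \<Longrightarrow> set ys \<subseteq> insert z (f ` set xs) \<Longrightarrow> G ys = 0"
    and ne: "xs \<noteq> []"
  shows "taylor_comp G F xs = G (map f xs)"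
proof -
  let ?n = "length xs"
  have F: "F b \<in> insert z (f ` set xs)" if "b \<noteq> []" "set b \<subseteq> set xs" for b
    using that single long by (cases b rule: remdups_adj.cases) auto
  have comp_term: "G (map F (blocks is xs)) = (if is = replicate ?n 1 then G (map f xs) else 0)"
    if comp: "is \<in> compositions k ?n" for k "is"
  proof (cases "is = replicate ?n 1")
    case True
    have "blocks (replicate (length ys) 1) ys = map (\<lambda>x. [x]) ys" for ys :: "'a list"
      by (induction ys) auto
    then have "map F (blocks is xs) = map f xs" using True single by simp
    then show ?thesis using True by simp
  next
    case False
    have is1: "sum_list is = ?n" "\<forall>i\<in>set is. 1 \<le> i" using comp by (auto simp: compositions_def)
    have "\<exists>i\<in>set is. 2 \<le> i"
    proof (rule ccontr)
      assume "\<not> ?thesis"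
      then have "\<forall>i\<in>set is. i = 1" using is1 by (metis le_antisym not_less_eq_eq one_add_one plus_1_eq_Suc)
      then have "is = replicate (length is) 1" by (simp add: replicate_length_same)
      moreover from this have "length is = ?n" using is1(1)
        by (metis mult.right_neutral sum_list_replicate of_nat_id)
      ultimately show False using False by simp
    qed
    then have "\<exists>b\<in>set (blocks is xs). 2 \<le> length b"
      using map_length_blocks[OF is1(1)] by (metis imageE list.set_map)
    then have 1: "z \<in> set (map F (blocks is xs))" using long by force
    have "[] \<notin> set (blocks is xs)"
      using map_length_blocks[OF is1(1)] is1(2) by (metis image_eqI list.set_map list.size(3) not_one_le_zero)
    then have "set (map F (blocks is xs)) \<subseteq> insert z (f ` set xs)"
      unfolding set_map using F set_block_subset[of _ "is" xs]
      by (intro image_subsetI) metis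
    with 1 zero False show ?thesis by simp
  qed
  have "taylor_comp G F xs = (\<Sum>k = 1..?n. \<Sum>is\<in>compositions k ?n. if is = replicate ?n 1 then G (map f xs) else 0)"
    unfolding taylor_comp_def by (intro sum.cong refl comp_term) 
  also have "\<dots> = (\<Sum>k = 1..?n. if k = ?n then G (map f xs) else 0)"
    by (rule sum.cong[OF refl], subst sum.delta[OF finite_compositions])
       (auto simp: compositions_def sum_list_replicate)
  also have "\<dots> = G (map f xs)" using ne by (simp add: Suc_le_eq)
  finally show ?thesis .
qed

section \<open>Polynomial forms\<close>

lemma pderiv_sum: "pderiv (\<Sum>i\<in>X. f i) = (\<Sum>i\<in>X. pderiv (f i))"
  by (induction X rule: infinite_finite_induct) (simp_all add: pderiv_add)

lemma pderiv_poly_integral0 [simp]: "pderiv (poly_integral0 p) = p"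
proof -
  have "pderiv (poly_integral0 p) = (\<Sum>i\<le>degree p. monom (coeff p i) i)"
    unfolding poly_integral0_def pderiv_sum
    by (simp add: pderiv_monom del: of_nat_Suc)
  then show ?thesis by (simp add: poly_as_sum_of_monoms)
qed

lemma poly_poly_integral0_0 [simp]: "poly (poly_integral0 p) 0 = 0"
  by (simp add: poly_integral0_def poly_sum poly_monom)

lemma poly_eqI_pderiv:
  fixes p q :: "'k::field_char_0 poly"
  assumes "pderiv p = pderiv q" "poly p 0 = poly q 0"
  shows "p = q"
proof -
  have "pderiv (p - q) = 0" using assms by (simp add: pderiv_diff)
  then obtain h where "p - q = [:h:]" using pderiv_iszero by blast
  moreover have "poly (p - q) 0 = 0" using assms by simp
  ultimately show ?thesis by simp
qed

lemma poly_integral0_0 [simp]: "poly_integral0 0 = 0"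
  by (simp add: poly_integral0_def)

definition poly_deriv_rel :: "('k::field_char_0 \<Rightarrow> 'k) \<Rightarrow> ('k \<Rightarrow> 'k) \<Rightarrow> bool" where
  "poly_deriv_rel f f' \<longleftrightarrow> (\<exists>p. f = poly p \<and> f' = poly (pderiv p))"

interpretation poly_differentiation: differentiation UNIV poly_deriv_rel
proof
  show "poly_deriv_rel (\<lambda>_. c) (\<lambda>_. 0)" for c :: 'a
    unfolding poly_deriv_rel_def by (intro exI[of _ "[:c:]"]) auto
  show "poly_deriv_rel (\<lambda>t. f t + g t) (\<lambda>t. f' t + g' t)"
    if fg: "poly_deriv_rel f f'" "poly_deriv_rel g g'" for f f' g g' :: "'a \<Rightarrow> 'a"
  proof -
    obtain p q where "f = poly p" "f' = poly (pderiv p)" "g = poly q" "g' = poly (pderiv q)"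
      using fg by (auto simp: poly_deriv_rel_def)
    then show ?thesis
      unfolding poly_deriv_rel_def by (intro exI[of _ "p + q"]) (auto simp: pderiv_add)
  qed
  show "poly_deriv_rel (\<lambda>t. f t * g t) (\<lambda>t. f' t * g t + f t * g' t)"
    if fg: "poly_deriv_rel f f'" "poly_deriv_rel g g'" for f f' g g' :: "'a \<Rightarrow> 'a"
  proof -
    obtain p q where "f = poly p" "f' = poly (pderiv p)" "g = poly q" "g' = poly (pderiv q)"
      using fg by (auto simp: poly_deriv_rel_def)
    then show ?thesis
      unfolding poly_deriv_rel_def by (intro exI[of _ "p * q"]) (auto simp: pderiv_mult)
  qed
  show "f s = g s" if "poly_deriv_rel f h" "poly_deriv_rel g h" "f 0 = g 0"
    for f g h :: "'a \<Rightarrow> 'a" and s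
    using that by (auto simp: poly_deriv_rel_def poly_eq_poly_eq_iff dest: poly_eqI_pderiv)
qed

definition poly_iterated_integral :: "'k::field_char_0 poly list \<Rightarrow> 'k poly" where
  "poly_iterated_integral as = foldl (\<lambda>q a. poly_integral0 (q * a)) 1 as"

lemma poly_iterated_integral_Nil [simp]: "poly_iterated_integral [] = 1"
  by (simp add: poly_iterated_integral_def)

lemma poly_iterated_integral_snoc [simp]:
  "poly_iterated_integral (as @ [a]) = poly_integral0 (poly_iterated_integral as * a)"
  by (simp add: poly_iterated_integral_def)

lemma poly_iterated_integral_zero: "0 \<in> set as \<Longrightarrow> poly_iterated_integral as = 0"
  by (induction as rule: rev_induct) auto

text \<open>
  The substitution \<open>t \<mapsto> s t\<close> in an iterated integral moves the upper end from \<open>u\<close> to \<open>s u\<close>.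
\<close>

lemma poly_iterated_integral_scale:
  "poly_iterated_integral (map (\<lambda>a. smult s (pcompose a [:0, s:])) as) =
     pcompose (poly_iterated_integral as) [:0, s:]"
proof (induction as rule: rev_induct)
  case (snoc a as)
  show ?case
    by (rule poly_eqI_pderiv)
       (simp_all add: snoc.IH pderiv_pcompose pderiv_pCons pcompose_mult poly_pcompose mult_ac)
qed (simp add: pcompose_1)

text \<open>
  Strong induction on the length: the blocks in the recursion are shorter, so there the
  recursive functions may be replaced by the logarithm, whose recursion is already known.
\<close>

lemma poly_M_eq_log_iterated_integral:
  "poly (poly_M as) s = conv_series (fps_ln 1) (\<lambda>b. poly (poly_iterated_integral b) s) as"
proof (induction "length as" arbitrary: as s rule: less_induct)
  case less
  consider "as = []" | a where "as = [a]" | "2 \<le> length as"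
    by (cases as rule: remdups_adj.cases) auto
  then show ?case
  proof cases
    case 1
    then show ?thesis by (simp add: poly_M.simps conv_series_def fps_ln_0)
  next
    case (2 a)
    then show ?thesis
      using poly_iterated_integral_snoc[of "[]" a]
      by (simp add: poly_M.simps conv_series_singleton fps_ln_nth)
  next
    case 3
    let ?M = "\<lambda>t. conv_series (fps_ln 1) (\<lambda>b. poly (poly_iterated_integral b) t)"
    let ?f = "\<lambda>j is. let p = sum_list (take j is) in
                      (\<Prod>b\<leftarrow>blocks (take j is) (take p as). poly_M b) * (as ! p) *
                      (\<Prod>b\<leftarrow>blocks (drop j is) (drop (Suc p) as). poly_M b)"
    let ?N = "\<lambda>j is. poly (poly_integral0 (?f j is))"
    have "poly (poly_M as) s = (\<Sum>k = 1..length as - 1. bernoulli_num k / fact k *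
            (\<Sum>j = 0..k. (-1) ^ j * of_nat (k choose j) *
               (\<Sum>is\<in>compositions k (length as - 1). ?N j is s)))"
      using 3 by (subst poly_M.simps) (simp add: poly_sum Let_def)
    also have "\<dots> = ?M s as"
    proof (rule poly_differentiation.magnus_recursion[where A = poly, symmetric])
      show "poly_deriv_rel (\<lambda>t. poly (poly_iterated_integral (b @ [a])) t)
              (\<lambda>t. poly (poly_iterated_integral b) t * poly a t)" for b and a :: "'a poly"
        unfolding poly_deriv_rel_def
        by (intro exI[of _ "poly_iterated_integral (b @ [a])"]) auto
      show "poly (poly_iterated_integral b) 0 = 0" if "b \<noteq> []" for b :: "'a poly list"
        using that by (cases b rule: rev_cases) auto
      fix j k "is" assume jk: "j \<le> k" and comp: "is \<in> compositions k (length as - 1)"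
      let ?p = "sum_list (take j is)"
      have "?p \<le> sum_list is"
        by (metis append_take_drop_id le_add1 sum_list_append)
      then have p: "?p < length as" using comp 3 by (auto simp: compositions_def)
      have left: "poly (poly_M b) t = ?M t b" if "b \<in> set (blocks (take j is) (take ?p as))" for b t
        using set_blocks_length_le[OF that] p by (intro less) auto
      have right: "poly (poly_M b) t = ?M t b" if "b \<in> set (blocks (drop j is) (drop (Suc ?p) as))" for b t
        using set_blocks_length_le[OF that] p by (intro less) auto
      have "poly (?f j is) = (\<lambda>t. let p = sum_list (take j is) in
              (\<Prod>b\<leftarrow>blocks (take j is) (take p as). ?M t b) * poly (as ! p) t *
              (\<Prod>b\<leftarrow>blocks (drop j is) (drop (Suc p) as). ?M t b))"
      proof
        fix t
        have evaluate: "poly (\<Prod>b\<leftarrow>bs. poly_M b) t = (\<Prod>b\<leftarrow>bs. poly (poly_M b) t)"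
          for bs :: "'a poly list list"
          by (induction bs) simp_all
        have l: "map (\<lambda>b. poly (poly_M b) t) (blocks (take j is) (take ?p as)) =
            map (?M t) (blocks (take j is) (take ?p as))"
          by (rule map_cong[OF refl left])
        have r: "map (\<lambda>b. poly (poly_M b) t) (blocks (drop j is) (drop (Suc ?p) as)) =
            map (?M t) (blocks (drop j is) (drop (Suc ?p) as))"
          by (rule map_cong[OF refl right])
        show "poly (?f j is) t = (let p = sum_list (take j is) in
              (\<Prod>b\<leftarrow>blocks (take j is) (take p as). ?M t b) * poly (as ! p) t *
              (\<Prod>b\<leftarrow>blocks (drop j is) (drop (Suc p) as). ?M t b))"
          unfolding Let_def poly_mult evaluate l r ..
      qed
      then show "poly_deriv_rel (?N j is) (\<lambda>t. let p = sum_list (take j is) in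
              (\<Prod>b\<leftarrow>blocks (take j is) (take p as). ?M t b) * poly (as ! p) t *
              (\<Prod>b\<leftarrow>blocks (drop j is) (drop (Suc p) as). ?M t b))"
        unfolding poly_deriv_rel_def by (intro exI[of _ "poly_integral0 (?f j is)"]) simp
    qed (use 3 in auto)
    finally show ?thesis .
  qed
qed

lemma poly_lambda_one_forms:
  assumes "as \<noteq> []"
  shows "poly_lambda (map poly_one_form as) = whitney_dt (poly (poly_iterated_integral as) 1)"
proof (cases as rule: remdups_adj.cases)
  case (2 a)
  then show ?thesis
    using poly_iterated_integral_snoc[of "[]" a] by (simp add: poly_one_form_def whitney_dt_def)
next
  case (3 a b cs)
  then show ?thesis
    by (simp add: poly_one_form_def poly_simplex_integral_def poly_iterated_integral_def comp_def)
qed (use assms in simp)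

lemma poly_phi_one_forms:
  "poly_phi (map poly_one_form as) =
     whitney_dt (conv_series (fps_ln 1) (\<lambda>b. poly (poly_iterated_integral b) 1) as)"
proof -
  have "poly_phi (map poly_one_form as) = whitney_dt (conv_series (fps_ln 1)
      (\<lambda>b. poly (poly_iterated_integral (map snd b)) 1) (map poly_one_form as))"
    unfolding poly_phi_def
  proof (rule taylor_comp_log_coeff)
    fix b :: "'a poly_form list"
    assume b: "b \<noteq> []" "set b \<subseteq> set (map poly_one_form as)"
    then have "b = map poly_one_form (map snd b)"
      by (auto simp: poly_one_form_def intro!: map_idI[symmetric])
    then show "poly_lambda b = whitney_dt (poly (poly_iterated_integral (map snd b)) 1)"
      using b(1) poly_lambda_one_forms[of "map snd b"] by simp
  qed
  then show ?thesis by (simp add: conv_series_map comp_def poly_one_form_def)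
qed

text \<open>
  The pullback is strict, so the coefficient is that of \<open>log \<circ> \<lambda>\<close> on the pulled back forms, and
  an iterated integral of these up to \<open>1\<close> is one of the original forms up to \<open>s\<close>.
\<close>

lemma poly_phi_s_one_forms:
  assumes "as \<noteq> []"
  shows "poly_phi_s s (map poly_one_form as) = whitney_dt (poly (poly_M as) s)"
proof -
  let ?pull = "\<lambda>a. smult s (pcompose a [:0, s:])"
  let ?f = "\<lambda>\<omega>. poly_pullback s [\<omega>]"
  have f: "?f (poly_one_form a) = poly_one_form (?pull a)" for a
    by (simp add: poly_one_form_def)
  have "poly_phi_s s (map poly_one_form as) = poly_phi (map ?f (map poly_one_form as))"
    unfolding poly_phi_s_def
  proof (rule taylor_comp_strict[where z = "(0, 0)"])
    show "poly_pullback s b = (0, 0)" if "2 \<le> length b" for b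
      using that by (cases b rule: remdups_adj.cases) auto
    fix ys assume ys: "(0, 0) \<in> set ys" "set ys \<subseteq> insert (0, 0) (?f ` set (map poly_one_form as))"
    then have "ys = map poly_one_form (map snd ys)"
      by (auto simp: poly_one_form_def intro!: map_idI[symmetric])
    moreover have "0 \<in> set (map snd ys)" using ys(1) by force
    then have "conv_series (fps_ln 1) (\<lambda>b. poly (poly_iterated_integral b) 1) (map snd ys) = 0"
      by (rule conv_series_zero_letter) (simp add: poly_iterated_integral_zero)
    ultimately show "poly_phi ys = 0"
      using poly_phi_one_forms[of "map snd ys"] by (simp add: whitney_dt_def zero_prod_def)
  qed (use assms in auto)
  also have "map ?f (map poly_one_form as) = map poly_one_form (map ?pull as)"
    by (simp add: f)
  also have "poly_phi \<dots> = whitney_dt (poly (poly_M as) s)"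
    unfolding poly_phi_one_forms conv_series_map poly_iterated_integral_scale
    by (simp add: poly_pcompose poly_M_eq_log_iterated_integral)
  finally show ?thesis .
qed

section \<open>Smooth functions and their iterated integrals\<close>

definition real_deriv_rel :: "(real \<Rightarrow> real) \<Rightarrow> (real \<Rightarrow> real) \<Rightarrow> bool" where
  "real_deriv_rel f f' \<longleftrightarrow> (\<forall>x\<in>{0..1}. (f has_real_derivative f' x) (at x within {0..1}))"

interpretation real_differentiation: differentiation "{0..1}" real_deriv_rel
proof
  show "f s = g s" if D: "real_deriv_rel f h" "real_deriv_rel g h" and "f 0 = g 0" "s \<in> {0..1}"
    for f g h :: "real \<Rightarrow> real" and s
  proof -
    have "\<exists>c. \<forall>x\<in>{0..1}. f x - g x = c"
    proof (rule has_field_derivative_zero_constant)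
      show "((\<lambda>x. f x - g x) has_field_derivative 0) (at x within {0..1})" if "x \<in> {0..1}" for x
        using D that DERIV_diff[of f "h x" x "{0..1}" g "h x"] by (simp add: real_deriv_rel_def)
    qed simp
    then obtain c where "\<forall>x\<in>{0..1}. f x - g x = c" by blast
    from bspec[OF this, of 0] bspec[OF this, of s] that show ?thesis by simp
  qed
qed (auto simp: real_deriv_rel_def intro!: derivative_eq_intros)

lemma real_deriv_rel_cong:
  assumes "real_deriv_rel f f'" "\<And>x. x \<in> {0..1} \<Longrightarrow> g x = f x" "\<And>x. x \<in> {0..1} \<Longrightarrow> g' x = f' x"
  shows "real_deriv_rel g g'"
  unfolding real_deriv_rel_def
proof
  fix x :: real assume x: "x \<in> {0..1}"
  then have "(f has_real_derivative g' x) (at x within {0..1})"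
    using assms by (simp add: real_deriv_rel_def)
  then show "(g has_real_derivative g' x) (at x within {0..1})"
    unfolding has_field_derivative_def
    by (rule has_derivative_transform[OF x assms(2), rotated])
qed

lemma real_deriv_rel_continuous: "real_deriv_rel f f' \<Longrightarrow> continuous_on {0..1} f"
  unfolding real_deriv_rel_def by (blast intro: DERIV_continuous_on)

lemma real_deriv_rel_integral:
  "continuous_on {0..1} f \<Longrightarrow> real_deriv_rel (\<lambda>s. integral {0..s} f) f"
  by (simp add: real_deriv_rel_def integral_has_real_derivative)

text \<open>
  A set of functions that contains a derivative of each of its members consists of smooth
  functions. Closure under products then follows from the product rule for first derivatives.
\<close>

lemma smooth01_coinduct:
  assumes "f \<in> X" and step: "\<And>f. f \<in> X \<Longrightarrow> \<exists>f'\<in>X. real_deriv_rel f f'"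
  shows "f \<in> smooth01"
proof -
  obtain d where d: "\<And>f. f \<in> X \<Longrightarrow> d f \<in> X \<and> real_deriv_rel f (d f)"
    using step by metis
  have "(d ^^ n) f \<in> X" for n using assms(1) d by (induction n) auto
  then have "real_deriv_rel ((d ^^ n) f) ((d ^^ Suc n) f)" for n using d by simp
  then show ?thesis
    unfolding smooth01_def real_deriv_rel_def by (intro CollectI exI[of _ "\<lambda>n. (d ^^ n) f"]) simp
qed

lemma smooth01_deriv:
  assumes "f \<in> smooth01"
  obtains f' where "f' \<in> smooth01" "real_deriv_rel f f'"
proof -
  obtain E :: "nat \<Rightarrow> real \<Rightarrow> real" where E: "E 0 = f" "\<And>n. real_deriv_rel (E n) (E (Suc n))"
    using assms by (auto simp: smooth01_def real_deriv_rel_def)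
  have "E 1 \<in> smooth01"
    by (rule smooth01_coinduct[of _ "range E"]) (use E in auto)
  then show ?thesis using that E(1) E(2)[of 0] by simp
qed

lemma smooth01_antiderivative:
  assumes "real_deriv_rel f f'" "f' \<in> smooth01"
  shows "f \<in> smooth01"
  by (rule smooth01_coinduct[of _ "insert f smooth01"]) (use assms in \<open>auto elim: smooth01_deriv\<close>)

lemma smooth01_continuous: "f \<in> smooth01 \<Longrightarrow> continuous_on {0..1} f"
  by (erule smooth01_deriv) (rule real_deriv_rel_continuous)

lemma smooth01_cong:
  assumes "f \<in> smooth01" "\<And>x. x \<in> {0..1} \<Longrightarrow> g x = f x"
  shows "g \<in> smooth01"
proof -
  obtain f' where "f' \<in> smooth01" "real_deriv_rel f f'" using assms(1) by (rule smooth01_deriv)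
  then show ?thesis
    using assms(2) real_deriv_rel_cong[of f f' g f'] smooth01_antiderivative[of g f'] by blast
qed

lemma smooth01_integral: "f \<in> smooth01 \<Longrightarrow> (\<lambda>s. integral {0..s} f) \<in> smooth01"
  using real_deriv_rel_integral smooth01_antiderivative smooth01_continuous by blast

lemma smooth01_const: "(\<lambda>_. c) \<in> smooth01"
  by (rule smooth01_coinduct[of _ "range (\<lambda>c _. c)"]) (auto intro: real_differentiation.const)

text \<open>
  The closure of the smooth functions under sums and products contains a derivative of each of
  its members, by the product rule, and so adds nothing to the smooth functions.
\<close>

inductive_set smooth01_algebra :: "(real \<Rightarrow> real) set" where
  base: "f \<in> smooth01 \<Longrightarrow> f \<in> smooth01_algebra"
| add: "f \<in> smooth01_algebra \<Longrightarrow> g \<in> smooth01_algebra \<Longrightarrow> (\<lambda>t. f t + g t) \<in> smooth01_algebra"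
| mult: "f \<in> smooth01_algebra \<Longrightarrow> g \<in> smooth01_algebra \<Longrightarrow> (\<lambda>t. f t * g t) \<in> smooth01_algebra"

lemma smooth01_algebra_eq: "smooth01_algebra = smooth01"
proof
  have "\<exists>f'\<in>smooth01_algebra. real_deriv_rel f f'" if "f \<in> smooth01_algebra" for f
    using that
  proof induction
    case (base f)
    then obtain f' where "f' \<in> smooth01" "real_deriv_rel f f'" by (rule smooth01_deriv)
    then show ?case by (blast intro: smooth01_algebra.base)
  next
    case (add f g)
    then obtain f' g' where fg: "f' \<in> smooth01_algebra" "real_deriv_rel f f'"
        "g' \<in> smooth01_algebra" "real_deriv_rel g g'" by blast
    then have "(\<lambda>t. f' t + g' t) \<in> smooth01_algebra"
      by (intro smooth01_algebra.add)
    with real_differentiation.add[OF fg(2,4)] show ?case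
      by (intro bexI[where x = "\<lambda>t. f' t + g' t"])
  next
    case (mult f g)
    then obtain f' g' where fg: "f' \<in> smooth01_algebra" "real_deriv_rel f f'"
        "g' \<in> smooth01_algebra" "real_deriv_rel g g'" by blast
    with mult.hyps have "(\<lambda>t. f' t * g t + f t * g' t) \<in> smooth01_algebra"
      by (intro smooth01_algebra.add smooth01_algebra.mult)
    with real_differentiation.mult[OF fg(2,4)] show ?case
      by (intro bexI[where x = "\<lambda>t. f' t * g t + f t * g' t"])
  qed
  then show "smooth01_algebra \<subseteq> smooth01"
    using smooth01_coinduct[of _ smooth01_algebra] by blast
qed (auto intro: smooth01_algebra.base)

lemmas smooth01_add = smooth01_algebra.add[unfolded smooth01_algebra_eq]
  and smooth01_mult = smooth01_algebra.mult[unfolded smooth01_algebra_eq]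

lemma smooth01_sum: "(\<And>i. i \<in> X \<Longrightarrow> f i \<in> smooth01) \<Longrightarrow> (\<lambda>t. \<Sum>i\<in>X. f i t) \<in> smooth01"
  by (induction X rule: infinite_finite_induct) (simp_all add: smooth01_const smooth01_add)

lemma smooth01_prod_list: "(\<And>b. b \<in> set bs \<Longrightarrow> f b \<in> smooth01) \<Longrightarrow> (\<lambda>t. \<Prod>b\<leftarrow>bs. f b t) \<in> smooth01"
  by (induction bs) (simp_all add: smooth01_const smooth01_mult)

lemma smooth01_conv_series:
  assumes "\<And>b. set b \<subseteq> set xs \<Longrightarrow> (\<lambda>t. P t b) \<in> smooth01"
  shows "(\<lambda>t. conv_series f (P t) xs) \<in> smooth01"
  unfolding conv_series_def conv_power_def
  by (intro smooth01_sum smooth01_mult smooth01_const smooth01_prod_list assms set_block_subset)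

definition iterated_integral :: "(real \<Rightarrow> real) list \<Rightarrow> real \<Rightarrow> real" where
  "iterated_integral as = foldl (\<lambda>q a s. integral {0..s} (\<lambda>t. q t * a t)) (\<lambda>_. 1) as"

lemma iterated_integral_Nil [simp]: "iterated_integral [] = (\<lambda>_. 1)"
  by (simp add: iterated_integral_def)

lemma iterated_integral_snoc [simp]:
  "iterated_integral (as @ [a]) = (\<lambda>s. integral {0..s} (\<lambda>t. iterated_integral as t * a t))"
  by (simp add: iterated_integral_def)

lemma iterated_integral_zero: "(\<lambda>_. 0) \<in> set as \<Longrightarrow> iterated_integral as = (\<lambda>_. 0)"
  by (induction as rule: rev_induct) auto

lemma iterated_integral_continuous:
  "set as \<subseteq> {a. continuous_on {0..1} a} \<Longrightarrow> continuous_on {0..1} (iterated_integral as)"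
proof (induction as rule: rev_induct)
  case (snoc a as)
  then have "continuous_on {0..1} (\<lambda>t. iterated_integral as t * a t)"
    by (intro continuous_on_mult) auto
  then show ?case
    using real_deriv_rel_integral real_deriv_rel_continuous by simp blast
qed simp

lemma iterated_integral_deriv:
  assumes "set (as @ [a]) \<subseteq> {a. continuous_on {0..1} a}"
  shows "real_deriv_rel (iterated_integral (as @ [a])) (\<lambda>t. iterated_integral as t * a t)"
  unfolding iterated_integral_snoc
  by (intro real_deriv_rel_integral continuous_on_mult iterated_integral_continuous) (use assms in auto)

lemma iterated_integral_smooth01:
  "set as \<subseteq> smooth01 \<Longrightarrow> iterated_integral as \<in> smooth01"
  by (induction as rule: rev_induct) (simp_all add: smooth01_const smooth01_mult smooth01_integral)

lemma continuous_on_scale: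
  fixes a :: "real \<Rightarrow> real"
  assumes "continuous_on {0..1} a" "s \<in> {0..1}"
  shows "continuous_on {0..1} (\<lambda>t. a (s * t))"
  by (rule continuous_on_compose2[OF assms(1)])
     (use assms(2) in \<open>auto intro!: continuous_intros mult_le_one\<close>)

text \<open>
  Both sides vanish at \<open>u = 0\<close> and have the same derivative in \<open>u\<close>. This form of the argument
  covers \<open>s = 0\<close> as well, where \<open>t \<mapsto> s t\<close> is not a change of variables.
\<close>

lemma iterated_integral_scale:
  assumes "set as \<subseteq> {a. continuous_on {0..1} a}" "s \<in> {0..1}" "u \<in> {0..1}"
  shows "iterated_integral (map (\<lambda>a t. s * a (s * t)) as) u = iterated_integral as (s * u)"
  using assms
proof (induction as arbitrary: u rule: rev_induct)
  case (snoc a as)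
  let ?pull = "\<lambda>a t. s * a (s * t)"
  let ?h = "\<lambda>t. iterated_integral (map ?pull as) t * ?pull a t"
  have cont: "set (map ?pull (as @ [a])) \<subseteq> {a. continuous_on {0..1} a}"
    using snoc.prems continuous_on_scale[of _ s] by (auto intro!: continuous_on_mult)
  have "real_deriv_rel (iterated_integral (map ?pull (as @ [a]))) ?h"
    using iterated_integral_deriv[of "map ?pull as" "?pull a"] cont by simp
  moreover have "real_deriv_rel (\<lambda>t. iterated_integral (as @ [a]) (s * t)) ?h"
    unfolding real_deriv_rel_def
  proof
    fix x :: real assume x: "x \<in> {0..1}"
    have sub: "(\<lambda>t. s * t) ` {0..1} \<subseteq> {0..1}"
      using snoc.prems by (auto intro: mult_le_one)
    have "(iterated_integral (as @ [a]) has_real_derivative iterated_integral as (s * x) * a (s * x))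
        (at (s * x) within {0..1})"
      using iterated_integral_deriv[of as a] snoc.prems sub x unfolding real_deriv_rel_def by blast
    then have "(iterated_integral (as @ [a]) has_real_derivative iterated_integral as (s * x) * a (s * x))
        (at (s * x) within (\<lambda>t. s * t) ` {0..1})"
      using sub by (rule has_field_derivative_subset)
    moreover have "((\<lambda>t. s * t) has_real_derivative s) (at x within {0..1})"
      by (auto intro!: derivative_eq_intros)
    ultimately have "(iterated_integral (as @ [a]) \<circ> (\<lambda>t. s * t) has_real_derivative
        iterated_integral as (s * x) * a (s * x) * s) (at x within {0..1})"
      by (rule DERIV_image_chain)
    moreover have "?h x = iterated_integral as (s * x) * a (s * x) * s"
      using snoc x by simp
    ultimately show "((\<lambda>t. iterated_integral (as @ [a]) (s * t)) has_real_derivative ?h x) (at x within {0..1})"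
      by (simp only: comp_def)
  qed
  ultimately show ?case
    by (rule real_differentiation.unique) (use snoc.prems in auto)
qed simp

text \<open>
  The argument is the one for polynomials. Equality with the logarithm is available only on
  \<open>[0,1]\<close>, which contains every domain of integration, and the integrands have to be shown
  continuous.
\<close>

lemma smooth_M_eq_log_iterated_integral:
  assumes "set as \<subseteq> smooth01" "s \<in> {0..1}"
  shows "smooth_M as s = conv_series (fps_ln 1) (\<lambda>b. iterated_integral b s) as"
  using assms
proof (induction "length as" arbitrary: as s rule: less_induct)
  case less
  consider "as = []" | a where "as = [a]" | "2 \<le> length as"
    by (cases as rule: remdups_adj.cases) auto
  then show ?case
  proof cases
    case 1
    then show ?thesis by (simp add: smooth_M.simps conv_series_def fps_ln_0)
  next
    case (2 a)
    then show ?thesis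
      using iterated_integral_snoc[of "[]" a]
      by (simp add: smooth_M.simps conv_series_singleton fps_ln_nth)
  next
    case 3
    let ?M = "\<lambda>t. conv_series (fps_ln 1) (\<lambda>b. iterated_integral b t)"
    let ?g = "\<lambda>j is t. let p = sum_list (take j is) in
                      (\<Prod>b\<leftarrow>blocks (take j is) (take p as). ?M t b) * (as ! p) t *
                      (\<Prod>b\<leftarrow>blocks (drop j is) (drop (Suc p) as). ?M t b)"
    let ?N = "\<lambda>j is s. let p = sum_list (take j is) in integral {0..s} (\<lambda>t.
                      (\<Prod>b\<leftarrow>blocks (take j is) (take p as). smooth_M b t) * (as ! p) t *
                      (\<Prod>b\<leftarrow>blocks (drop j is) (drop (Suc p) as). smooth_M b t))"
    have "smooth_M as s = (\<Sum>k = 1..length as - 1. bernoulli_num k / fact k *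
            (\<Sum>j = 0..k. (-1) ^ j * of_nat (k choose j) *
               (\<Sum>is\<in>compositions k (length as - 1). ?N j is s)))"
      using 3 by (subst smooth_M.simps) simp
    also have "\<dots> = ?M s as"
    proof (rule real_differentiation.magnus_recursion[where A = "\<lambda>a. a", symmetric])
      show "real_deriv_rel (\<lambda>t. iterated_integral (b @ [a]) t) (\<lambda>t. iterated_integral b t * a t)"
        if "set (b @ [a]) \<subseteq> set as" for b a
        using that less.prems smooth01_continuous by (intro iterated_integral_deriv) blast
      show "iterated_integral b 0 = 0" if "b \<noteq> []" for b :: "(real \<Rightarrow> real) list"
        using that by (cases b rule: rev_cases) auto
      fix j k "is" assume jk: "j \<le> k" and comp: "is \<in> compositions k (length as - 1)"
      let ?p = "sum_list (take j is)"
      have "?p \<le> sum_list is"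
        by (metis append_take_drop_id le_add1 sum_list_append)
      then have p: "?p < length as" using comp 3 by (auto simp: compositions_def)
      have left_set: "set b \<subseteq> smooth01" if "b \<in> set (blocks (take j is) (take ?p as))" for b
        using set_block_subset[OF that] set_take_subset[of ?p as] less.prems(1) by blast
      have right_set: "set b \<subseteq> smooth01" if "b \<in> set (blocks (drop j is) (drop (Suc ?p) as))" for b
        using set_block_subset[OF that] set_drop_subset[of "Suc ?p" as] less.prems(1) by blast
      have left: "smooth_M b t = ?M t b" if "b \<in> set (blocks (take j is) (take ?p as))" "t \<in> {0..1}" for b t
        using set_blocks_length_le[OF that(1)] p left_set that by (intro less) auto
      have right: "smooth_M b t = ?M t b" if "b \<in> set (blocks (drop j is) (drop (Suc ?p) as))" "t \<in> {0..1}" for b t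
        using set_blocks_length_le[OF that(1)] p right_set that by (intro less) auto
      have smooth: "(\<lambda>t. ?M t b) \<in> smooth01" if "set b \<subseteq> smooth01" for b
        using that by (intro smooth01_conv_series) (auto intro!: iterated_integral_smooth01)
      have "as ! ?p \<in> smooth01" using p less.prems(1) by auto
      then have "?g j is \<in> smooth01"
        unfolding Let_def
        by (intro smooth01_mult smooth01_prod_list)
           (erule smooth[OF left_set] | assumption | erule smooth[OF right_set])+
      then have "real_deriv_rel (\<lambda>s. integral {0..s} (?g j is)) (?g j is)"
        by (intro real_deriv_rel_integral smooth01_continuous)
      then show "real_deriv_rel (?N j is) (?g j is)"
      proof (rule real_deriv_rel_cong)
        fix x :: real assume x: "x \<in> {0..1}"
        have "smooth_M b t = ?M t b" if "b \<in> set (blocks (take j is) (take ?p as))" "t \<in> {0..x}" for b t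
          using left that x by auto
        moreover have "smooth_M b t = ?M t b" if "b \<in> set (blocks (drop j is) (drop (Suc ?p) as))" "t \<in> {0..x}" for b t
          using right that x by auto
        ultimately show "?N j is x = integral {0..x} (?g j is)"
          unfolding Let_def
          by (intro Henstock_Kurzweil_Integration.integral_cong arg_cong2[where f = "(*)"] arg_cong[where f = prod_list] map_cong refl) auto
      qed simp
    qed (use 3 less.prems in \<open>auto simp: Let_def\<close>)
    finally show ?thesis .
  qed
qed

lemma smooth_M_smooth01:
  assumes "set as \<subseteq> smooth01"
  shows "smooth_M as \<in> smooth01"
proof (rule smooth01_cong)
  show "(\<lambda>t. conv_series (fps_ln 1) (\<lambda>b. iterated_integral b t) as) \<in> smooth01"
    using assms iterated_integral_smooth01 by (intro smooth01_conv_series) auto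
qed (rule smooth_M_eq_log_iterated_integral[OF assms])

section \<open>Simplex integrals and smooth forms\<close>

text \<open>
  The upper end \<open>u\<close> is variable because fixing the last coordinate of a point of the simplex
  leaves a simplex with that coordinate as upper end.
\<close>

definition truncated_simplex :: "nat \<Rightarrow> real \<Rightarrow> (nat \<Rightarrow> real) set" where
  "truncated_simplex n u = {t. (\<forall>i<n. 0 \<le> t i \<and> t i \<le> u) \<and> (\<forall>i j. i \<le> j \<and> j < n \<longrightarrow> t i \<le> t j)}"

lemma ordered_simplex_eq: "ordered_simplex n = truncated_simplex n 1"
  by (simp add: ordered_simplex_def truncated_simplex_def)

lemma truncated_simplex_Suc:
  "t \<in> truncated_simplex (Suc n) u \<longleftrightarrow> t n \<in> {0..u} \<and> t \<in> truncated_simplex n (t n)"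
proof
  assume "t n \<in> {0..u} \<and> t \<in> truncated_simplex n (t n)"
  then have t: "0 \<le> t n" "t n \<le> u" "\<And>i. i < n \<Longrightarrow> 0 \<le> t i \<and> t i \<le> t n"
    and mono: "\<And>i j. i \<le> j \<Longrightarrow> j < n \<Longrightarrow> t i \<le> t j"
    by (auto simp: truncated_simplex_def)
  have "0 \<le> t i \<and> t i \<le> u" if "i < Suc n" for i
    using that t(1,2) t(3)[of i] by (cases "i = n") auto
  moreover have "t i \<le> t j" if "i \<le> j" "j < Suc n" for i j
    using that t(3)[of i] mono[of i j] by (cases "i = n"; cases "j = n") auto
  ultimately show "t \<in> truncated_simplex (Suc n) u"
    by (simp add: truncated_simplex_def)
qed (auto simp: truncated_simplex_def)

lemma truncated_simplex_cong:
  "(\<And>i. i < n \<Longrightarrow> t i = t' i) \<Longrightarrow> t \<in> truncated_simplex n u \<longleftrightarrow> t' \<in> truncated_simplex n u"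
  by (auto simp: truncated_simplex_def)

interpretation lborel_product: product_sigma_finite "\<lambda>_::nat. lborel :: real measure"
  by standard

lemma measurable_truncated_simplex [measurable]:
  "Measurable.pred (PiM {..<n} (\<lambda>_. lborel)) (\<lambda>t. t \<in> truncated_simplex n u)"
proof -
  have eq: "(\<lambda>t. t \<in> truncated_simplex n u) = (\<lambda>t. (\<forall>i\<in>{..<n}. 0 \<le> t i \<and> t i \<le> u) \<and>
      (\<forall>j\<in>{..<n}. \<forall>i\<in>{..j}. t i \<le> t j))"
    by (auto simp: truncated_simplex_def fun_eq_iff)
  have le: "Measurable.pred (PiM {..<n} (\<lambda>_. lborel)) (\<lambda>t. f t \<le> g t)"
    if "f \<in> borel_measurable (PiM {..<n} (\<lambda>_. lborel))"
      "g \<in> borel_measurable (PiM {..<n} (\<lambda>_. lborel))"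
    for f g :: "(nat \<Rightarrow> real) \<Rightarrow> real"
    unfolding pred_def using that by (rule borel_measurable_le)
  have component: "(\<lambda>t. t i) \<in> borel_measurable (PiM {..<n} (\<lambda>_. lborel))" if "i < n" for i
    using measurable_component_singleton[of i "{..<n}" "\<lambda>_. lborel"] that by simp
  have "Measurable.pred (PiM {..<n} (\<lambda>_. lborel))
      (\<lambda>t::nat \<Rightarrow> real. (\<forall>i\<in>{..<n}. 0 \<le> t i \<and> t i \<le> u) \<and> (\<forall>j\<in>{..<n}. \<forall>i\<in>{..j}. t i \<le> t j))"
    by (intro pred_intros_logic pred_intros_finite le borel_measurable_const component) auto
  then show ?thesis unfolding eq .
qed

text \<open>
  The functions are continuous on \<open>[0,1]\<close> only, and need not be measurable elsewhere. On the
  simplex each factor may be multiplied by the indicator of \<open>[0,1]\<close>, and the product of these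
  truncated factors is an integrable majorant.
\<close>

lemma integrable_simplex_product:
  fixes as :: "(real \<Rightarrow> real) list"
  assumes "set as \<subseteq> {a. continuous_on {0..1} a}" "u \<le> 1"
  shows "integrable (PiM {..<length as} (\<lambda>_. lborel))
           (\<lambda>t. indicator (truncated_simplex (length as) u) t * (\<Prod>i<length as. (as ! i) (t i)))"
proof -
  let ?n = "length as"
  let ?P = "PiM {..<?n} (\<lambda>_. lborel :: real measure)"
  let ?G = "\<lambda>t. \<Prod>i<?n. indicat_real {0..1} (t i) * (as ! i) (t i)"
  have G: "integrable ?P ?G"
  proof (rule lborel_product.product_integrable_prod[where f = "\<lambda>i x. indicator {0..1} x * (as ! i) x :: real"])
    fix i assume "i \<in> {..<?n}"
    then have "continuous_on {0..1} (as ! i)" using assms(1) nth_mem by blast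
    then show "integrable lborel (\<lambda>x. indicator {0..1} x * (as ! i) x)"
      using borel_integrable_compact[of "{0..1}" "as ! i"] by simp
  qed simp
  have eq: "indicator (truncated_simplex ?n u) t * (\<Prod>i<?n. (as ! i) (t i)) =
      (if t \<in> truncated_simplex ?n u then ?G t else 0)" for t
  proof (cases "t \<in> truncated_simplex ?n u")
    case True
    then have "t i \<in> {0..1}" if "i < ?n" for i
      using that assms(2) by (force simp: truncated_simplex_def)
    then show ?thesis using True by (auto intro!: prod.cong)
  qed simp
  show ?thesis unfolding eq
  proof (rule Bochner_Integration.integrable_bound[OF G])
    note [measurable] = borel_measurable_integrable[OF G]
    show "(\<lambda>t. if t \<in> truncated_simplex ?n u then ?G t else 0) \<in> borel_measurable ?P"
      by measurable
  qed auto
qed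

text \<open>
  Fubini's theorem, with the last coordinate as the outer variable.
\<close>

lemma simplex_integral_eq_iterated_integral:
  assumes "set as \<subseteq> {a. continuous_on {0..1} a}" "u \<in> {0..1}"
  shows "(LINT t : truncated_simplex (length as) u | PiM {..<length as} (\<lambda>_. lborel).
            (\<Prod>i<length as. (as ! i) (t i))) = iterated_integral as u"
  using assms
proof (induction as arbitrary: u rule: rev_induct)
  case Nil
  show ?case
    by (simp add: set_lebesgue_integral_def PiM_empty lebesgue_integral_count_space_finite truncated_simplex_def)
next
  case (snoc a as)
  let ?n = "length as"
  let ?f = "\<lambda>t. indicator (truncated_simplex (Suc ?n) u) t * (\<Prod>i<Suc ?n. ((as @ [a]) ! i) (t i)) :: real"
  let ?J = "\<lambda>z. LINT t : truncated_simplex ?n z | PiM {..<?n} (\<lambda>_. lborel). (\<Prod>i<?n. (as ! i) (t i))"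
  let ?h = "\<lambda>z. iterated_integral as z * a z"
  have cont: "continuous_on {0..u} ?h"
    using snoc.prems
    by (intro continuous_on_subset[of "{0..1}" ?h "{0..u}"] continuous_on_mult iterated_integral_continuous) auto
  have un: "{..<Suc ?n} = {?n} \<union> {..<?n}" by auto
  \<comment> \<open>The singleton comes first in the union because the coordinates of the first set become the
      outer integration variables.\<close>
  have int: "integrable (PiM ({?n} \<union> {..<?n}) (\<lambda>_. lborel)) ?f"
    using integrable_simplex_product[of "as @ [a]" u] snoc.prems unfolding un[symmetric] by simp
  have split: "?f (merge {?n} {..<?n} (x, y)) = indicator {0..u} (x ?n) * a (x ?n) *
      (indicator (truncated_simplex ?n (x ?n)) y * (\<Prod>i<?n. (as ! i) (y i)))" for x y :: "nat \<Rightarrow> real"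
  proof -
    let ?t = "merge {?n} {..<?n} (x, y)"
    have tn: "?t ?n = x ?n" and ti: "\<And>i. i < ?n \<Longrightarrow> ?t i = y i"
      by (simp_all add: merge_def)
    have "?t \<in> truncated_simplex (Suc ?n) u \<longleftrightarrow> x ?n \<in> {0..u} \<and> y \<in> truncated_simplex ?n (x ?n)"
      unfolding truncated_simplex_Suc tn using truncated_simplex_cong[of ?n ?t y] ti by blast
    moreover have "(\<Prod>i<Suc ?n. ((as @ [a]) ! i) (?t i)) = (\<Prod>i<?n. (as ! i) (y i)) * a (x ?n)"
      by (simp add: tn) (auto simp: nth_append ti intro!: prod.cong)
    ultimately show ?thesis by (auto simp: indicator_def)
  qed
  have inner: "(LINT y|PiM {..<?n} (\<lambda>_. lborel). ?f (merge {?n} {..<?n} (x, y))) =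
      indicator {0..u} (x ?n) * ?h (x ?n)" for x :: "nat \<Rightarrow> real"
  proof (cases "x ?n \<in> {0..u}")
    case True
    then have "?J (x ?n) = iterated_integral as (x ?n)"
      using snoc.prems by (intro snoc.IH) auto
    then show ?thesis unfolding split by (simp add: set_lebesgue_integral_def)
  next
    case False
    then show ?thesis unfolding split by simp
  qed
  have "(LINT t : truncated_simplex (length (as @ [a])) u | PiM {..<length (as @ [a])} (\<lambda>_. lborel).
            (\<Prod>i<length (as @ [a]). ((as @ [a]) ! i) (t i))) =
        (LINT t|PiM ({?n} \<union> {..<?n}) (\<lambda>_. lborel). ?f t)"
    unfolding un[symmetric] by (simp add: set_lebesgue_integral_def)
  also have "\<dots> = (LINT x|PiM {?n} (\<lambda>_. lborel). LINT y|PiM {..<?n} (\<lambda>_. lborel). ?f (merge {?n} {..<?n} (x, y)))"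
    by (rule lborel_product.product_integral_fold[OF _ _ _ int]) auto
  also have "\<dots> = (LINT x|PiM {?n} (\<lambda>_. lborel). indicator {0..u} (x ?n) * ?h (x ?n))"
    unfolding inner ..
  also have "\<dots> = (LINT z|lborel. indicator {0..u} z * ?h z)"
  proof (rule lborel_product.product_integral_singleton)
    show "(\<lambda>z. indicator {0..u} z * ?h z) \<in> borel_measurable lborel"
      using borel_integrable_compact[OF compact_Icc cont] by (simp add: borel_measurable_integrable)
  qed
  also have "\<dots> = (LINT z : {0..u} | lborel. ?h z)"
    by (simp add: set_lebesgue_integral_def)
  also have "\<dots> = integral {0..u} ?h"
    by (rule set_borel_integral_eq_integral) (rule borel_integrable_atLeastAtMost'[OF cont])
  finally show ?case by simp
qed

lemma smooth_lambda_one_forms: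
  assumes "as \<noteq> []" "set as \<subseteq> {a. continuous_on {0..1} a}"
  shows "smooth_lambda (map smooth_one_form as) = whitney_dt (iterated_integral as 1)"
proof (cases as rule: remdups_adj.cases)
  case (2 a)
  then show ?thesis
    using iterated_integral_snoc[of "[]" a] by (simp add: smooth_one_form_def whitney_dt_def)
next
  case (3 a b cs)
  have "smooth_lambda (map smooth_one_form as) = whitney_dt (smooth_simplex_integral as)"
    unfolding 3 by (simp add: smooth_one_form_def comp_def)
  also have "smooth_simplex_integral as = iterated_integral as 1"
    unfolding smooth_simplex_integral_def ordered_simplex_eq
    using assms by (intro simplex_integral_eq_iterated_integral) auto
  finally show ?thesis .
qed (use assms in simp)

lemma smooth_phi_one_forms:
  assumes "set as \<subseteq> {a. continuous_on {0..1} a}"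
  shows "smooth_phi (map smooth_one_form as) =
     whitney_dt (conv_series (fps_ln 1) (\<lambda>b. iterated_integral b 1) as)"
proof -
  have "smooth_phi (map smooth_one_form as) = whitney_dt (conv_series (fps_ln 1)
      (\<lambda>b. iterated_integral (map snd b) 1) (map smooth_one_form as))"
    unfolding smooth_phi_def
  proof (rule taylor_comp_log_coeff)
    fix b :: "smooth_form list"
    assume b: "b \<noteq> []" "set b \<subseteq> set (map smooth_one_form as)"
    then have "b = map smooth_one_form (map snd b)"
      by (auto simp: smooth_one_form_def intro!: map_idI[symmetric])
    moreover have "set (map snd b) \<subseteq> {a. continuous_on {0..1} a}"
      using b(2) assms by (force simp: smooth_one_form_def)
    ultimately show "smooth_lambda b = whitney_dt (iterated_integral (map snd b) 1)"
      using b(1) smooth_lambda_one_forms[of "map snd b"] by simp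
  qed
  then show ?thesis by (simp add: conv_series_map comp_def smooth_one_form_def)
qed

lemma smooth_phi_s_one_forms:
  assumes ne: "as \<noteq> []" and as: "set as \<subseteq> smooth01" and s: "s \<in> {0..1}"
  shows "smooth_phi_s s (map smooth_one_form as) = whitney_dt (smooth_M as s)"
proof -
  let ?C = "{a. continuous_on {0..1} a} :: (real \<Rightarrow> real) set"
  let ?pull = "\<lambda>a t. s * a (s * t)"
  let ?f = "\<lambda>\<omega>. smooth_pullback s [\<omega>]"
  let ?z = "(\<lambda>_. 0, \<lambda>_. 0) :: smooth_form"
  have f: "?f (smooth_one_form a) = smooth_one_form (?pull a)" for a
    by (simp add: smooth_one_form_def)
  have C: "set as \<subseteq> ?C" using as smooth01_continuous by blast
  have pull: "?pull a \<in> ?C" if "a \<in> set as" for a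
    using C s that continuous_on_scale[of a s] by (auto intro!: continuous_on_mult)
  have "smooth_phi_s s (map smooth_one_form as) = smooth_phi (map ?f (map smooth_one_form as))"
    unfolding smooth_phi_s_def
  proof (rule taylor_comp_strict[where z = ?z])
    show "smooth_pullback s b = ?z" if "2 \<le> length b" for b
      using that by (cases b rule: remdups_adj.cases) auto
    fix ys assume ys: "?z \<in> set ys" "set ys \<subseteq> insert ?z (?f ` set (map smooth_one_form as))"
    then have "ys = map smooth_one_form (map snd ys)"
      by (auto simp: smooth_one_form_def intro!: map_idI[symmetric])
    moreover have "set (map snd ys) \<subseteq> ?C"
    proof
      fix a assume "a \<in> set (map snd ys)"
      then obtain \<omega> where "\<omega> \<in> set ys" "a = snd \<omega>" by auto
      then have "a = (\<lambda>_. 0) \<or> a \<in> ?pull ` set as"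
        using ys(2) by (force simp: smooth_one_form_def)
      then show "a \<in> ?C" using pull by auto
    qed
    moreover have "(\<lambda>_. 0) \<in> set (map snd ys)" using ys(1) by force
    then have "conv_series (fps_ln 1) (\<lambda>b. iterated_integral b 1) (map snd ys) = 0"
      by (rule conv_series_zero_letter) (simp add: iterated_integral_zero)
    ultimately show "smooth_phi ys = 0"
      using smooth_phi_one_forms[of "map snd ys"] by (simp add: whitney_dt_def zero_prod_def)
  qed (use ne in auto)
  also have "map ?f (map smooth_one_form as) = map smooth_one_form (map ?pull as)"
    by (simp add: f)
  also have "smooth_phi \<dots> = whitney_dt (conv_series (fps_ln 1) (\<lambda>b. iterated_integral (map ?pull b) 1) as)"
    using pull by (subst smooth_phi_one_forms) (auto simp: conv_series_map)
  also have "conv_series (fps_ln 1) (\<lambda>b. iterated_integral (map ?pull b) 1) as =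
      conv_series (fps_ln 1) (\<lambda>b. iterated_integral b s) as"
  proof (rule conv_series_cong)
    show "iterated_integral (map ?pull b) 1 = iterated_integral b s" if "set b \<subseteq> set as" for b
      using iterated_integral_scale[of b s 1] that C s by auto
  qed
  also have "\<dots> = smooth_M as s"
    by (rule smooth_M_eq_log_iterated_integral[OF as s, symmetric])
  finally show ?thesis .
qed

section \<open>The Taylor coefficients of the family of morphisms\<close>

theorem theorem2p10:
  shows "(\<forall>(as :: (real \<Rightarrow> real) list) (s :: real).
            as \<noteq> [] \<longrightarrow> set as \<subseteq> smooth01 \<longrightarrow> s \<in> {0..1} \<longrightarrow>
              smooth_M as \<in> smooth01 \<and>
              smooth_phi_s s (map smooth_one_form as) = whitney_dt (smooth_M as s)) \<and>
         (\<forall>(as :: 'k::field_char_0 poly list) (s :: 'k).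
            as \<noteq> [] \<longrightarrow>
              poly_phi_s s (map poly_one_form as) = whitney_dt (poly (poly_M as) s))"
  using smooth_M_smooth01 smooth_phi_s_one_forms poly_phi_s_one_forms by blast

end
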